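(* Let $m,n,d$ be positive integers such that $m,n\ge 2$, $d>2$, and $(m,d)\neq(2,4)$ or $(n,d)\neq(2,4)$. Then there exists a polyconvex polynomial $f:\mathbb{R}^{m\times n}\to\mathbb{R}$ of degree $d$ that is not SOS polyconvex.
   Context: Let $N=\sum_{s=1}^{\min(m,n)}\binom{m}{s}\binom{n}{s}$ and let $p:\mathbb{R}^{m\times n}\to\mathbb{R}^N$ map a matrix $X$ to the list (in some fixed order) of all its minors of orders $1,\dots,\min(m,n)$. A polynomial is SOS if it is a finite sum of squares of real polynomials. A function $f:\mathbb{R}^{m\times n}\to\mathbb{R}\cup\{+\infty\}$ is polyconvex if there is a convex function $g:\mathbb{R}^N\to\mathbb{R}\cup\{+\infty\}$ with $f=g\circ p$. A polynomial $f:\mathbb{R}^{m\times n}\to\mathbb{R}$ is SOS polyconvex if there is a polynomial map $q:\mathbb{R}^{m\times n}\to\mathbb{R}^N$ such that $f(X)-f(Y)-\langle q(Y),p(X)-p(Y)\rangle$ is an SOS polynomial in the entries of $X$ and $Y$.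
   Formalization: The claim fails for odd d > min(m,n), where no polyconvex polynomial of degree d exists, and for d = 3, where every polyconvex polynomial is SOS polyconvex; the theorem therefore also assumes that if d is odd then 5 ≤ d ≤ min(m,n). All even d are covered. *)

theory Defs
  imports "HOL-Analysis.Analysis" "Jordan_Normal_Form.Determinant"
begin

no_notation Matrix.vec_index (infixl "$" 100)
no_notation Matrix.scalar_prod (infix "\<bullet>" 70)

text \<open>
  Matrices with \<open>m\<close> rows and \<open>n\<close> columns are the elements of \<open>real ^ 'n ^ 'm\<close> with
  \<open>m = CARD('m)\<close> and \<open>n = CARD('n)\<close>. The index types are linearly ordered, so that a set of
  rows and a set of columns of equal size determine a minor including its sign.
\<close>

subsection \<open>Minors\<close>

typedef ('m, 'n) minor_index =
  "{(I :: 'm set, J :: 'n set). card I = card J \<and> 1 \<le> card I}"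
  by (rule exI[of _ "({undefined}, {undefined})"]) simp

instance minor_index :: (finite, finite) finite
proof
  have "range (Rep_minor_index :: ('a, 'b) minor_index \<Rightarrow> _) \<subseteq> UNIV" by simp
  hence "finite (range (Rep_minor_index :: ('a, 'b) minor_index \<Rightarrow> _))"
    by (rule finite_subset) simp
  thus "finite (UNIV :: ('a, 'b) minor_index set)"
    by (rule finite_imageD) (simp add: inj_on_def Rep_minor_index_inject)
qed

lemma card_minor_index:
  "CARD(('m::finite, 'n::finite) minor_index) =
     (\<Sum>s = 1..min CARD('m) CARD('n). (CARD('m) choose s) * (CARD('n) choose s))"
proof -
  let ?S = "{(I :: 'm set, J :: 'n set). card I = card J \<and> 1 \<le> card I}"
  let ?T = "\<lambda>s. {I :: 'm set. card I = s} \<times> {J :: 'n set. card J = s}"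
  have le: "card (I :: 'm set) \<le> CARD('m)" "card (J :: 'n set) \<le> CARD('n)" for I J
    by (simp_all add: card_mono)
  have "CARD(('m, 'n) minor_index) = card ?S"
    using type_definition.card[OF type_definition_minor_index] .
  also have "?S = (\<Union>s \<in> {1..min CARD('m) CARD('n)}. ?T s)"
    using le by auto metis
  also have "card \<dots> = (\<Sum>s = 1..min CARD('m) CARD('n). card (?T s))"
    by (rule card_UN_disjoint) auto
  also have "\<dots> = (\<Sum>s = 1..min CARD('m) CARD('n). (CARD('m) choose s) * (CARD('n) choose s))"
    using n_subsets[of "UNIV :: 'm set"] n_subsets[of "UNIV :: 'n set"]
    by (simp add: card_cartesian_product)
  finally show ?thesis .
qed

definition minor :: "real ^ 'n::{finite,linorder} ^ 'm::{finite,linorder} \<Rightarrow> 'm set \<Rightarrow> 'n set \<Rightarrow> real"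
  where "minor X I J =
    Determinant.det (Matrix.mat (card I) (card J)
      (\<lambda>(i, j). X $ (sorted_list_of_set I ! i) $ (sorted_list_of_set J ! j)))"

definition minors ::
    "real ^ 'n::{finite,linorder} ^ 'm::{finite,linorder} \<Rightarrow> real ^ ('m, 'n) minor_index"
  where "minors X = (\<chi> k. case Rep_minor_index k of (I, J) \<Rightarrow> minor X I J)"


subsection \<open>Polynomials\<close>

text \<open>
  Since the reals are infinite, real polynomials in the entries of a matrix are identified with
  polynomial functions. An exponent \<open>\<alpha>\<close> stands for the monomial
  \<open>\<Prod>i j. (X $ i $ j) ^ \<alpha> i j\<close>; the representation required below, with exactly the monomials
  of nonzero coefficient, exists and is unique for every nonzero polynomial.
\<close>

definition has_degree :: "(real ^ 'n::finite ^ 'm::finite \<Rightarrow> real) \<Rightarrow> nat \<Rightarrow> bool"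
  where "has_degree f d \<longleftrightarrow>
    (\<exists>(A :: ('m \<Rightarrow> 'n \<Rightarrow> nat) set) c.
        finite A \<and> A \<noteq> {} \<and> (\<forall>\<alpha>\<in>A. c \<alpha> \<noteq> 0) \<and>
        f = (\<lambda>X. \<Sum>\<alpha>\<in>A. c \<alpha> * (\<Prod>i\<in>UNIV. \<Prod>j\<in>UNIV. (X $ i $ j) ^ \<alpha> i j)) \<and>
        d = Max ((\<lambda>\<alpha>. \<Sum>i\<in>UNIV. \<Sum>j\<in>UNIV. \<alpha> i j) ` A))"

definition is_sos :: "('a::real_normed_vector \<Rightarrow> real) \<Rightarrow> bool"
  where "is_sos F \<longleftrightarrow>
    (\<exists>hs. (\<forall>h\<in>set hs. real_polynomial_function h) \<and> F = (\<lambda>z. \<Sum>h\<leftarrow>hs. (h z)\<^sup>2))"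


subsection \<open>Polyconvexity\<close>

text \<open>
  Convexity of functions with values in the reals extended by \<open>+\<infinity>\<close>; the case of a zero weight
  is unproblematic because \<open>0 * \<infinity> = 0\<close> in \<^typ>\<open>ereal\<close>.
\<close>

definition ext_convex :: "('a::real_vector \<Rightarrow> ereal) \<Rightarrow> bool"
  where "ext_convex g \<longleftrightarrow>
    (\<forall>x. g x \<noteq> -\<infinity>) \<and>
    (\<forall>x y. \<forall>u v :: real. 0 \<le> u \<longrightarrow> 0 \<le> v \<longrightarrow> u + v = 1 \<longrightarrow>
        g (u *\<^sub>R x + v *\<^sub>R y) \<le> ereal u * g x + ereal v * g y)"

definition polyconvex ::
    "(real ^ 'n::{finite,linorder} ^ 'm::{finite,linorder} \<Rightarrow> ereal) \<Rightarrow> bool"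
  where "polyconvex f \<longleftrightarrow> (\<exists>g. ext_convex g \<and> f = g \<circ> minors)"

definition sos_polyconvex ::
    "(real ^ 'n::{finite,linorder} ^ 'm::{finite,linorder} \<Rightarrow> real) \<Rightarrow> bool"
  where "sos_polyconvex f \<longleftrightarrow>
    (\<exists>q. polynomial_function q \<and>
        is_sos (\<lambda>(X, Y). f X - f Y - q Y \<bullet> (minors X - minors Y)))"

end

theory Submission
  imports Defs
begin

text \<open>
  A direction \<open>V\<close> supported in a single row or column is one along which every minor is affine.
  Hence, if \<open>f\<close> is SOS polyconvex, the multiplier \<open>q\<close> drops out of the second difference of \<open>f\<close>
  along \<open>V\<close>, and the Hessian of \<open>f\<close> at \<open>Y\<close> in direction \<open>V\<close> is a sum of squares of polynomials
  that are linear in \<open>V\<close>. It therefore suffices to find a convex polynomial whose Hessian at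
  the points supported in one line, in the directions of a parallel line, is a nonnegative form that
  is not a sum of squares. With three entries per line this form is Choi's biquadratic form; with two
  it is a Motzkin-like form of degree four in the point. Terms that are flat to order four in \<open>V\<close>
  make the polynomial convex, and the degree is adjusted by an even power of an entry or, for odd
  \<open>d\<close>, by a minor of order \<open>d\<close>, which is linear in the minors.
\<close>

section \<open>Minors\<close>

text \<open>Only the factor with index \<open>k\<close> is perturbed, and a product is affine in
  each single factor, so the perturbations by \<open>v\<close> and by \<open>- v\<close> cancel to
  first order and nothing of higher order occurs.\<close>

lemma prod_second_difference:
  fixes a v :: "'i \<Rightarrow> 'a::comm_ring_1"
  assumes "finite S" and "\<And>i. i \<in> S \<Longrightarrow> i \<noteq> k \<Longrightarrow> v i = 0"
  shows "(\<Prod>i\<in>S. a i + v i) + (\<Prod>i\<in>S. a i - v i) = 2 * (\<Prod>i\<in>S. a i)"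
proof (cases "k \<in> S")
  case True
  have "(\<Prod>i\<in>S - {k}. a i + v i) = (\<Prod>i\<in>S - {k}. a i)"
    "(\<Prod>i\<in>S - {k}. a i - v i) = (\<Prod>i\<in>S - {k}. a i)"
    using assms(2) by (auto intro!: prod.cong)
  with True show ?thesis
    using assms(1) by (simp add: prod.remove[of S k] algebra_simps)
next
  case False
  then have "v i = 0" if "i \<in> S" for i using assms(2) that by blast
  then have "(\<Prod>i\<in>S. a i + v i) = (\<Prod>i\<in>S. a i)" "(\<Prod>i\<in>S. a i - v i) = (\<Prod>i\<in>S. a i)"
    by (auto intro!: prod.cong)
  then show ?thesis by simp
qed

text \<open>Minors are affine along every rank-one direction. Directions supported in one row or one
  column suffice here, and for them this is visible term by term in the Leibniz formula.\<close>

definition in_line :: "real ^ 'n ^ 'm \<Rightarrow> bool"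
  where "in_line V \<longleftrightarrow>
    (\<exists>r. \<forall>i j. i \<noteq> r \<longrightarrow> V $ i $ j = 0) \<or> (\<exists>s. \<forall>i j. j \<noteq> s \<longrightarrow> V $ i $ j = 0)"

lemma in_line_scaleR: "in_line V \<Longrightarrow> in_line (t *\<^sub>R V)"
  unfolding in_line_def by auto

lemma minor_leibniz:
  fixes X :: "real ^ 'n::{finite,linorder} ^ 'm::{finite,linorder}"
  assumes "card I = card J"
  shows "minor X I J = (\<Sum>p\<in>{p. p permutes {0..<card I}}. signof p *
    (\<Prod>i = 0..<card I. X $ (sorted_list_of_set I ! i) $ (sorted_list_of_set J ! p i)))"
proof -
  have "(\<Prod>i = 0..<card I. Matrix.mat (card I) (card J) (\<lambda>(i, j).
          X $ (sorted_list_of_set I ! i) $ (sorted_list_of_set J ! j)) $$ (i, p i))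
      = (\<Prod>i = 0..<card I. X $ (sorted_list_of_set I ! i) $ (sorted_list_of_set J ! p i))"
    if "p permutes {0..<card I}" for p
    using assms permutes_in_image[OF that] by (intro prod.cong) auto
  then show ?thesis
    unfolding minor_def Determinant.det_def using assms by simp
qed

text \<open>The factors of a Leibniz product come from pairwise distinct rows and pairwise distinct
  columns. A single row or column therefore meets at most one of them, and
  \<open>prod_second_difference\<close> applies to each product.\<close>

lemma minor_second_difference:
  fixes Y V :: "real ^ 'n::{finite,linorder} ^ 'm::{finite,linorder}"
  assumes V: "in_line V" and card: "card I = card J"
  shows "minor (Y + V) I J + minor (Y - V) I J = 2 * minor Y I J"
proof -
  let ?r = "\<lambda>i. sorted_list_of_set I ! i" and ?s = "\<lambda>j. sorted_list_of_set J ! j"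
  have r: "inj_on ?r {0..<card I}" and s: "inj_on ?s {0..<card I}"
    using card by (auto simp: inj_on_def nth_eq_iff_index_eq)
  have "(\<Prod>i = 0..<card I. (Y + V) $ ?r i $ ?s (p i)) + (\<Prod>i = 0..<card I. (Y - V) $ ?r i $ ?s (p i))
      = 2 * (\<Prod>i = 0..<card I. Y $ ?r i $ ?s (p i))"
    if p: "p permutes {0..<card I}" for p
  proof -
    have "\<exists>k. \<forall>i\<in>{0..<card I}. i \<noteq> k \<longrightarrow> V $ ?r i $ ?s (p i) = 0"
      using V unfolding in_line_def
    proof (elim disjE exE)
      fix a assume a: "\<forall>i j. i \<noteq> a \<longrightarrow> V $ i $ j = 0"
      show ?thesis
      proof (cases "a \<in> ?r ` {0..<card I}")
        case True
        then obtain k where "k \<in> {0..<card I}" "a = ?r k" by auto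
        then show ?thesis using a r by (metis inj_on_eq_iff)
      next
        case False
        then have "\<forall>i\<in>{0..<card I}. V $ ?r i $ ?s (p i) = 0" using a by auto
        then show ?thesis by blast
      qed
    next
      fix a assume a: "\<forall>i j. j \<noteq> a \<longrightarrow> V $ i $ j = 0"
      have sp: "inj_on (\<lambda>i. ?s (p i)) {0..<card I}"
        using s p by (simp add: inj_on_def permutes_in_image[OF p]) (metis permutes_def)
      show ?thesis
      proof (cases "a \<in> (\<lambda>i. ?s (p i)) ` {0..<card I}")
        case True
        then obtain k where "k \<in> {0..<card I}" "a = ?s (p k)" by auto
        then show ?thesis using a inj_onD[OF sp] by metis
      next
        case False
        then have "\<forall>i\<in>{0..<card I}. ?s (p i) \<noteq> a" by blast
        then show ?thesis using a by auto
      qed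
    qed
    then obtain k where "\<And>i. i \<in> {0..<card I} \<Longrightarrow> i \<noteq> k \<Longrightarrow> V $ ?r i $ ?s (p i) = 0" by blast
    then show ?thesis
      by (simp, intro prod_second_difference) auto
  qed
  then have "signof p * (\<Prod>i = 0..<card I. (Y + V) $ ?r i $ ?s (p i))
      + signof p * (\<Prod>i = 0..<card I. (Y - V) $ ?r i $ ?s (p i))
      = 2 * (signof p * (\<Prod>i = 0..<card I. Y $ ?r i $ ?s (p i)))"
    if "p permutes {0..<card I}" for p
    using that by (metis (no_types, lifting) distrib_left mult.left_commute)
  then show ?thesis
    unfolding minor_leibniz[OF card] by (simp add: sum.distrib[symmetric] sum_distrib_left)
qed

lemma minors_second_difference:
  fixes Y V :: "real ^ 'n::{finite,linorder} ^ 'm::{finite,linorder}"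
  assumes "in_line V"
  shows "minors (Y + V) + minors (Y - V) = 2 *\<^sub>R minors Y"
proof (rule Finite_Cartesian_Product.vec_eq_iff[THEN iffD2], rule allI)
  fix k :: "('m, 'n) minor_index"
  obtain I J where k: "Rep_minor_index k = (I, J)" by fastforce
  then have "card I = card J" using Rep_minor_index[of k] by auto
  with minor_second_difference[OF assms this, of Y] k
  show "(minors (Y + V) + minors (Y - V)) $ k = (2 *\<^sub>R minors Y) $ k"
    by (simp add: minors_def)
qed

text \<open>The entries are the minors of order one. Through these coordinates a convex function of
  the entries becomes a convex function on the space of all minors.\<close>

definition entry_index :: "'m \<times> 'n \<Rightarrow> ('m, 'n) minor_index"
  where "entry_index p = Abs_minor_index ({fst p}, {snd p})"

lemma minors_entry_index:
  fixes X :: "real ^ 'n::{finite,linorder} ^ 'm::{finite,linorder}"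
  shows "minors X $ entry_index p = X $ fst p $ snd p"
proof -
  have "Rep_minor_index (entry_index p) = ({fst p}, {snd p})"
    unfolding entry_index_def by (rule Abs_minor_index_inverse) simp
  then show ?thesis
    by (simp add: minors_def minor_leibniz)
qed

lemma polyconvexI:
  fixes f :: "real ^ 'n::{finite,linorder} ^ 'm::{finite,linorder} \<Rightarrow> real"
  assumes "convex_on UNIV G" and "\<And>X. f X = G (minors X)"
  shows "polyconvex (\<lambda>X. ereal (f X))"
  unfolding polyconvex_def
proof (intro exI conjI)
  show "ext_convex (\<lambda>z. ereal (G z))"
    using assms(1) unfolding ext_convex_def convex_on_def by auto
qed (use assms(2) in auto)


section \<open>Degree\<close>

definition monomial :: "('m::finite \<Rightarrow> 'n::finite \<Rightarrow> nat) \<Rightarrow> real ^ 'n ^ 'm \<Rightarrow> real"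
  where "monomial \<alpha> X = (\<Prod>i\<in>UNIV. \<Prod>j\<in>UNIV. (X $ i $ j) ^ \<alpha> i j)"

definition mdegree :: "('m::finite \<Rightarrow> 'n::finite \<Rightarrow> nat) \<Rightarrow> nat"
  where "mdegree \<alpha> = (\<Sum>i\<in>UNIV. \<Sum>j\<in>UNIV. \<alpha> i j)"

lemma monomial_add: "monomial (\<lambda>i j. \<alpha> i j + \<beta> i j) X = monomial \<alpha> X * monomial \<beta> X"
  by (simp add: monomial_def power_add prod.distrib)

lemma mdegree_add: "mdegree (\<lambda>i j. \<alpha> i j + \<beta> i j) = mdegree \<alpha> + mdegree \<beta>"
  by (simp add: mdegree_def sum.distrib)

lemma monomial_scaleR: "monomial \<alpha> (t *\<^sub>R X) = t ^ mdegree \<alpha> * monomial \<alpha> X"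
  by (simp add: monomial_def mdegree_def power_mult_distrib prod.distrib power_sum)

text \<open>This is only an upper bound: monomials may repeat, cancel or have coefficient 0, so sums
  and products need no bookkeeping. The exact degree is recovered from growth along a ray in
  \<open>has_degreeI\<close>.\<close>

inductive degree_le :: "nat \<Rightarrow> (real ^ 'n::finite ^ 'm::finite \<Rightarrow> real) \<Rightarrow> bool" for k
  where
    zero: "degree_le k (\<lambda>X. 0)"
  | add_monomial: "degree_le k f \<Longrightarrow> mdegree \<alpha> \<le> k \<Longrightarrow> degree_le k (\<lambda>X. f X + c * monomial \<alpha> X)"

lemma degree_le_monomial: "mdegree \<alpha> \<le> k \<Longrightarrow> degree_le k (\<lambda>X. c * monomial \<alpha> X)"
  using degree_le.add_monomial[OF degree_le.zero] by simp

lemma degree_le_const: "degree_le k (\<lambda>X. c)"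
  using degree_le_monomial[of "\<lambda>i j. 0" k c] by (simp add: monomial_def mdegree_def)

lemma degree_le_entry: "1 \<le> k \<Longrightarrow> degree_le k (\<lambda>X. X $ i $ j)"
proof -
  let ?\<alpha> = "\<lambda>i' j'. if i' = i \<and> j' = j then 1 else 0 :: nat"
  assume "1 \<le> k"
  moreover have "(\<Sum>j'\<in>UNIV. ?\<alpha> i' j') = (if i' = i then 1 else 0)" for i'
    by simp
  then have "mdegree ?\<alpha> = 1"
    unfolding mdegree_def by simp
  moreover have "monomial ?\<alpha> X = X $ i $ j" for X
  proof -
    have "(\<Prod>j'\<in>UNIV. (X $ i' $ j') ^ ?\<alpha> i' j') = (if i' = i then X $ i $ j else 1)" for i'
      by (cases "i' = i") (simp_all add: if_distrib[of "\<lambda>e. _ ^ e"] prod.delta cong: if_cong)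
    then show ?thesis unfolding monomial_def by simp
  qed
  ultimately show ?thesis
    using degree_le_monomial[of ?\<alpha> k 1] by simp
qed

lemma degree_le_mono: "degree_le k f \<Longrightarrow> k \<le> l \<Longrightarrow> degree_le l f"
  by (induction rule: degree_le.induct) (auto intro: degree_le.intros)

lemma degree_le_add:
  assumes "degree_le k f" and "degree_le k g"
  shows "degree_le k (\<lambda>X. f X + g X)"
  using assms(2)
proof (induction rule: degree_le.induct)
  case (add_monomial g \<alpha> c)
  then show ?case
    using degree_le.add_monomial[of k "\<lambda>X. f X + g X" \<alpha> c] by (simp add: add.assoc)
qed (simp add: assms(1))

lemma degree_le_mult_monomial:
  assumes "degree_le k f"
  shows "degree_le (k + mdegree \<alpha>) (\<lambda>X. f X * (c * monomial \<alpha> X))"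
  using assms
proof (induction rule: degree_le.induct)
  case zero
  show ?case using degree_le.zero by simp
next
  case (add_monomial f \<beta> b)
  have "degree_le (k + mdegree \<alpha>) (\<lambda>X. f X * (c * monomial \<alpha> X)
      + (b * c) * monomial (\<lambda>i j. \<beta> i j + \<alpha> i j) X)"
    using add_monomial by (intro degree_le.add_monomial) (auto simp: mdegree_add)
  then show ?case by (simp add: monomial_add algebra_simps)
qed

lemma degree_le_mult:
  assumes f: "degree_le k f" and "degree_le l g"
  shows "degree_le (k + l) (\<lambda>X. f X * g X)"
  using assms(2)
proof (induction rule: degree_le.induct)
  case zero
  show ?case using degree_le.zero by simp
next
  case (add_monomial g \<alpha> c)
  then have "degree_le (k + l) (\<lambda>X. f X * (c * monomial \<alpha> X))"
    using degree_le_mult_monomial[OF f] degree_le_mono by (metis add_left_mono)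
  from degree_le_add[OF add_monomial.IH this] show ?case
    by (simp add: distrib_left)
qed

lemma degree_le_power: "degree_le k f \<Longrightarrow> degree_le (n * k) (\<lambda>X. f X ^ n)"
proof (induction n)
  case 0
  show ?case using degree_le_const[of _ 1] by simp
next
  case (Suc n)
  then show ?case using degree_le_mult[of k f "n * k" "\<lambda>X. f X ^ n"] by simp
qed

lemma degree_le_cmult:
  assumes "degree_le k f"
  shows "degree_le k (\<lambda>X. c * f X)"
  using degree_le_mult[OF degree_le_const[of 0 c] assms] by simp

lemma degree_le_diff:
  assumes "degree_le k f" and "degree_le k g"
  shows "degree_le k (\<lambda>X. f X - g X)"
  using degree_le_add[OF assms(1) degree_le_cmult[OF assms(2), of "-1"]] by simp

lemma degree_le_sum:
  assumes "\<And>i. i \<in> S \<Longrightarrow> degree_le k (f i)"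
  shows "degree_le k (\<lambda>X. \<Sum>i\<in>S. f i X)"
  using assms by (induction S rule: infinite_finite_induct) (auto intro: degree_le.zero degree_le_add)

lemma degree_le_prod_card:
  assumes "finite S" and "card S = k" and "\<And>i. i \<in> S \<Longrightarrow> degree_le 1 (f i)"
  shows "degree_le k (\<lambda>X. \<Prod>i\<in>S. f i X)"
  unfolding assms(2)[symmetric] using assms(1,3)
proof (induction S)
  case empty
  show ?case using degree_le_const[of 0 1] by simp
next
  case (insert i S)
  then show ?case
    using degree_le_mult[of 1 "f i" "card S" "\<lambda>X. \<Prod>i\<in>S. f i X"] by simp
qed

lemma degree_le_minor:
  fixes I :: "'m::{finite,linorder} set" and J :: "'n::{finite,linorder} set"
  assumes "card I = card J"
  shows "degree_le (card I) (\<lambda>X. minor X I J)"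
  unfolding minor_leibniz[OF assms]
proof (intro degree_le_sum degree_le_cmult)
  fix p
  show "degree_le (card I) (\<lambda>X :: real ^ 'n::{finite,linorder} ^ 'm::{finite,linorder}.
      \<Prod>i = 0..<card I. X $ (sorted_list_of_set I ! i) $ (sorted_list_of_set J ! p i))"
    by (intro degree_le_prod_card degree_le_entry) auto
qed

lemma real_polynomial_function_entry:
  "real_polynomial_function (\<lambda>X :: real ^ 'n::finite ^ 'm::finite. X $ i $ j)"
  by (intro real_polynomial_function.intros(1)
      bounded_linear_compose[OF bounded_linear_vec_nth bounded_linear_vec_nth])

lemma degree_le_imp_real_polynomial_function:
  assumes "degree_le k f"
  shows "real_polynomial_function f"
  using assms
proof (induction rule: degree_le.induct)
  case (add_monomial f \<alpha> c)
  have "real_polynomial_function (\<lambda>X. monomial \<alpha> X)"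
    unfolding monomial_def
    by (intro real_polynomial_function_prod real_polynomial_function_power
        real_polynomial_function_entry) auto
  then show ?case
    by (intro real_polynomial_function.intros(2,3,4) add_monomial.IH)
qed auto

lemma degree_le_imp_sum:
  assumes "degree_le k f"
  obtains A c where "finite A" "\<And>\<alpha>. \<alpha> \<in> A \<Longrightarrow> mdegree \<alpha> \<le> k" "f = (\<lambda>X. \<Sum>\<alpha>\<in>A. c \<alpha> * monomial \<alpha> X)"
proof -
  have "\<exists>A c. finite A \<and> (\<forall>\<alpha>\<in>A. mdegree \<alpha> \<le> k) \<and> f = (\<lambda>X. \<Sum>\<alpha>\<in>A. c \<alpha> * monomial \<alpha> X)"
    using assms
  proof (induction rule: degree_le.induct)
    case zero
    show ?case by (intro exI[of _ "{}"]) auto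
  next
    case (add_monomial f \<beta> b)
    then obtain A c where A: "finite A" "\<forall>\<alpha>\<in>A. mdegree \<alpha> \<le> k" "f = (\<lambda>X. \<Sum>\<alpha>\<in>A. c \<alpha> * monomial \<alpha> X)"
      by blast
    \<comment> \<open>The exponent \<beta> may already belong to \<open>A\<close>, so the new
      coefficient is added to the old one. The first guard makes \<open>c\<close> count as 0 outside
      \<open>A\<close>.\<close>
    define c' where "c' = (\<lambda>\<alpha>. (if \<alpha> \<in> A then c \<alpha> else 0) + (if \<alpha> = \<beta> then b else 0))"
    have "(\<Sum>\<alpha>\<in>insert \<beta> A. c' \<alpha> * monomial \<alpha> X) = f X + b * monomial \<beta> X" for X
    proof -
      have "(\<Sum>\<alpha>\<in>insert \<beta> A. c' \<alpha> * monomial \<alpha> X)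
          = (\<Sum>\<alpha>\<in>insert \<beta> A. (if \<alpha> \<in> A then c \<alpha> * monomial \<alpha> X else 0))
          + (\<Sum>\<alpha>\<in>insert \<beta> A. (if \<alpha> = \<beta> then b * monomial \<alpha> X else 0))"
        unfolding c'_def by (subst sum.distrib[symmetric], intro sum.cong) (auto simp: distrib_right)
      also have "(\<Sum>\<alpha>\<in>insert \<beta> A. (if \<alpha> \<in> A then c \<alpha> * monomial \<alpha> X else 0)) = f X"
        unfolding A(3) using A(1) by (intro sum.mono_neutral_cong_right) auto
      finally show ?thesis using A(1) by simp
    qed
    then show ?case
      using A add_monomial.hyps by (intro exI[of _ "insert \<beta> A"] exI[of _ c']) auto
  qed
  then show ?thesis using that by blast
qed

text \<open>If only monomials of degree below \<open>d\<close> survived, the function would grow at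
  most like \<open>t ^ (d - 1)\<close> along each ray. Growth of order \<open>d\<close> along one
  ray thus replaces the computation of a leading coefficient.\<close>

lemma has_degreeI:
  fixes f :: "real ^ 'n::finite ^ 'm::finite \<Rightarrow> real"
  assumes le: "degree_le d f" and d: "d > 0"
    and growth: "\<And>t. t \<ge> 1 \<Longrightarrow> t ^ d \<le> f (t *\<^sub>R X)"
  shows "has_degree f d"
proof -
  obtain B c where B: "finite B" "\<And>\<alpha>. \<alpha> \<in> B \<Longrightarrow> mdegree \<alpha> \<le> d"
    "f = (\<lambda>X. \<Sum>\<alpha>\<in>B. c \<alpha> * monomial \<alpha> X)"
    using degree_le_imp_sum[OF le] by metis
  \<comment> \<open>The definition of \<open>has_degree\<close> admits nonzero coefficients
    only.\<close>
  define A where "A = {\<alpha>\<in>B. c \<alpha> \<noteq> 0}"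
  have fA: "f = (\<lambda>X. \<Sum>\<alpha>\<in>A. c \<alpha> * monomial \<alpha> X)"
    unfolding B(3) A_def using B(1) by (intro ext sum.mono_neutral_right) auto
  have A: "finite A" using B(1) by (simp add: A_def)
  have "\<exists>\<alpha>\<in>A. mdegree \<alpha> \<ge> d"
  proof (rule ccontr)
    assume "\<not> ?thesis"
    then have lt: "mdegree \<alpha> \<le> d - 1" if "\<alpha> \<in> A" for \<alpha> using that by force
    \<comment> \<open>With all degrees at most \<open>d - 1\<close>, the value at
      \<open>t *\<^sub>R X\<close> is at most \<open>t ^ (d - 1) * C\<close>. Comparison with
      \<open>t ^ d\<close> would bound every t \<ge> 1 by the constant \<open>C\<close>.\<close>
    define C where "C = (\<Sum>\<alpha>\<in>A. \<bar>c \<alpha> * monomial \<alpha> X\<bar>)"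
    have "t \<le> C" if t: "t \<ge> 1" for t
    proof -
      have "t ^ d \<le> (\<Sum>\<alpha>\<in>A. t ^ mdegree \<alpha> * (c \<alpha> * monomial \<alpha> X))"
        using growth[OF t] unfolding fA by (simp add: monomial_scaleR mult.left_commute)
      also have "\<dots> \<le> (\<Sum>\<alpha>\<in>A. t ^ (d - 1) * \<bar>c \<alpha> * monomial \<alpha> X\<bar>)"
      proof (rule sum_mono)
        fix \<alpha> assume "\<alpha> \<in> A"
        then have "t ^ mdegree \<alpha> \<le> t ^ (d - 1)" using lt t by (simp add: power_increasing)
        then show "t ^ mdegree \<alpha> * (c \<alpha> * monomial \<alpha> X) \<le> t ^ (d - 1) * \<bar>c \<alpha> * monomial \<alpha> X\<bar>"
          using t by (intro order_trans[OF mult_left_mono[OF abs_ge_self] mult_right_mono[OF _ abs_ge_zero]]) auto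
      qed
      also have "\<dots> = t ^ (d - 1) * C" by (simp add: C_def sum_distrib_left)
      finally have "t ^ (d - 1) * t \<le> t ^ (d - 1) * C"
        using d by (metis One_nat_def Suc_pred power_Suc2)
      then show ?thesis using t by simp
    qed
    from this[of "max 1 (C + 1)"] show False by auto
  qed
  then obtain \<alpha> where \<alpha>: "\<alpha> \<in> A" "mdegree \<alpha> \<ge> d" by blast
  have "Max (mdegree ` A) = d"
  proof (rule antisym)
    show "Max (mdegree ` A) \<le> d" using A \<alpha>(1) B(2) by (subst Max_le_iff) (auto simp: A_def)
    show "d \<le> Max (mdegree ` A)" using A \<alpha> by (meson Max_ge finite_imageI image_eqI le_trans)
  qed
  then show ?thesis
    unfolding has_degree_def
    using A \<alpha>(1) fA by (intro exI[of _ A] exI[of _ c]) (auto simp: A_def monomial_def mdegree_def fun_eq_iff)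
qed


section \<open>Hessians of SOS polyconvex polynomials\<close>

text \<open>Differentiability and polynomial dependence on the base point are proved together,
  because the product rule needs both for the factors. The second part makes the linear forms of
  \<open>sos_polyconvex_hessian\<close> polynomial in \<open>Y\<close>.\<close>

lemma real_polynomial_function_has_derivative:
  fixes h :: "'a::real_normed_vector \<Rightarrow> real"
  assumes "real_polynomial_function h"
  shows "\<exists>D. (\<forall>z. (h has_derivative D z) (at z)) \<and> (\<forall>w. real_polynomial_function (\<lambda>z. D z w))"
  using assms
proof (induction rule: real_polynomial_function.induct)
  case (linear f)
  then show ?case
    by (intro exI[of _ "\<lambda>z. f"]) (auto simp: bounded_linear_imp_has_derivative)
next
  case (const c)
  show ?case by (intro exI[of _ "\<lambda>z w. 0"]) auto
next
  case (add f g)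
  then obtain D E where
    "\<And>z. (f has_derivative D z) (at z)" "\<And>w. real_polynomial_function (\<lambda>z. D z w)"
    "\<And>z. (g has_derivative E z) (at z)" "\<And>w. real_polynomial_function (\<lambda>z. E z w)" by blast
  then show ?case
    by (intro exI[of _ "\<lambda>z w. D z w + E z w"]) (auto intro!: has_derivative_add)
next
  case (mult f g)
  then obtain D E where
    "\<And>z. (f has_derivative D z) (at z)" "\<And>w. real_polynomial_function (\<lambda>z. D z w)"
    "\<And>z. (g has_derivative E z) (at z)" "\<And>w. real_polynomial_function (\<lambda>z. E z w)" by blast
  with mult show ?case
    by (intro exI[of _ "\<lambda>z w. f z * E z w + D z w * g z"]) (auto intro!: has_derivative_mult real_polynomial_function.intros(3,4))
qed

text \<open>A nonzero coefficient of positive degree would make the absolute value tend to infinity.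
  The bound is asked only away from 0, because it will be applied to quotients by
  \<open>t\<close>.\<close>

lemma real_polynomial_function_bounded_imp_const:
  fixes p :: "real \<Rightarrow> real"
  assumes "real_polynomial_function p" and bound: "\<And>t. t \<noteq> 0 \<Longrightarrow> \<bar>p t\<bar> \<le> C"
  shows "p t = p 0"
proof -
  obtain a n where p: "p = (\<lambda>x. \<Sum>i\<le>n. a i * x ^ i)"
    using real_polynomial_function_imp_sum[OF assms(1)] by auto
  have "a k = 0" if "1 \<le> k" "k \<le> n" for k
  proof (rule ccontr)
    assume "a k \<noteq> 0"
    with that have "\<exists>k. k \<noteq> 0 \<and> k \<le> n \<and> a k \<noteq> 0" by (intro exI[of _ k]) auto
    from polyfun_extremal[OF this, of "C + 1"]
    have "\<forall>\<^sub>F z in at_infinity. \<bar>p z\<bar> \<ge> C + 1" unfolding p by simp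
    then obtain b where b: "\<And>z. norm z \<ge> b \<Longrightarrow> \<bar>p z\<bar> \<ge> C + 1"
      unfolding eventually_at_infinity by auto
    define z where "z = max b 1"
    have "norm z \<ge> b" "z \<noteq> 0" by (auto simp: z_def)
    with b bound show False by fastforce
  qed
  then have "a i * x ^ i = (if i = 0 then a 0 else 0)" if "i \<le> n" for i x
    using that by (cases i) auto
  then have "p x = a 0" for x unfolding p by simp
  then show ?thesis by simp
qed

text \<open>The bound at 0 gives a root there. After division by \<open>t\<close> the polynomial is
  bounded, hence constant.\<close>

lemma real_polynomial_function_linear_growth:
  fixes p :: "real \<Rightarrow> real"
  assumes "real_polynomial_function p" and bound: "\<And>t. (p t)\<^sup>2 \<le> C * t\<^sup>2"
  shows "p t = t * p 1"
proof -
  obtain a n where p: "p = (\<lambda>x. \<Sum>i\<le>n. a i * x ^ i)"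
    using real_polynomial_function_imp_sum[OF assms(1)] by auto
  have "p 0 = 0" using bound[of 0] by simp
  then obtain b where b: "\<And>z. p z = (z - 0) * (\<Sum>i<n. b i * z ^ i)"
    unfolding p using polyfun_linear_factor_root[of a 0 n] by metis
  let ?q = "\<lambda>z. \<Sum>i<n. b i * z ^ i"
  have q: "real_polynomial_function ?q"
    by (intro real_polynomial_function_sum real_polynomial_function.intros(2,4)
        real_polynomial_function_power real_polynomial_function.intros(1)) auto
  have "\<bar>?q z\<bar> \<le> sqrt C" if "z \<noteq> 0" for z
  proof -
    have "z\<^sup>2 * (?q z)\<^sup>2 \<le> z\<^sup>2 * C"
      using bound[of z] unfolding b by (simp add: power_mult_distrib mult.commute)
    then have "(?q z)\<^sup>2 \<le> C" using that by simp
    then show ?thesis by (metis real_le_rsqrt real_sqrt_abs real_sqrt_le_mono)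
  qed
  from real_polynomial_function_bounded_imp_const[OF q this] have "?q t = ?q 0" "?q 1 = ?q 0"
    by blast+
  then show ?thesis unfolding b by simp
qed

text \<open>Every \<open>h k\<close> in the SOS representation vanishes on the diagonal, so
  \<open>h k (Y + t *\<^sub>R V, Y)\<close> is of first order in \<open>t\<close>. Its derivative at
  0 is \<open>L k Y V\<close>, the partial derivative of \<open>h k\<close> in its first argument.
  In the second difference the multiplier \<open>q\<close> cancels; dividing by
  \<open>t\<^sup>2\<close> and letting \<open>t\<close> tend to 0 gives the sum of squares.\<close>

lemma sos_polyconvex_hessian:
  fixes f :: "real ^ 'n::{finite,linorder} ^ 'm::{finite,linorder} \<Rightarrow> real"
  assumes "sos_polyconvex f"
  obtains L :: "nat \<Rightarrow> real ^ 'n::{finite,linorder} ^ 'm::{finite,linorder} \<Rightarrow> real ^ 'n::{finite,linorder} ^ 'm::{finite,linorder} \<Rightarrow> real" and N :: nat where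
    "\<And>k Y. linear (L k Y)"
    "\<And>k V. real_polynomial_function (\<lambda>Y. L k Y V)"
    "\<And>Y V \<phi>. in_line V \<Longrightarrow> isCont \<phi> 0 \<Longrightarrow>
       (\<And>t. f (Y + t *\<^sub>R V) + f (Y - t *\<^sub>R V) - 2 * f Y = t\<^sup>2 * \<phi> t) \<Longrightarrow>
       (\<Sum>k<N. (L k Y V)\<^sup>2) = \<phi> 0 / 2"
proof -
  obtain q hs where hs: "\<forall>h\<in>set hs. real_polynomial_function h"
    and F: "(\<lambda>(X, Y). f X - f Y - q Y \<bullet> (minors X - minors Y)) = (\<lambda>z. \<Sum>h\<leftarrow>hs. (h z)\<^sup>2)"
    using assms unfolding sos_polyconvex_def is_sos_def by blast
  define N where "N = length hs"
  \<comment> \<open>Padding by the zero polynomial lets the facts about \<open>h k\<close> hold for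
    all \<open>k\<close>, without a bound.\<close>
  define h where "h k = (if k < N then hs ! k else (\<lambda>z. 0))" for k
  have h: "real_polynomial_function (h k)" for k
    using hs by (auto simp: h_def N_def)
  have F: "f X - f Y - q Y \<bullet> (minors X - minors Y) = (\<Sum>k<N. (h k (X, Y))\<^sup>2)" for X Y
    using fun_cong[OF F, of "(X, Y)"]
    by (simp add: sum_list_sum_nth h_def N_def atLeast0LessThan)
  have "(\<Sum>k<N. (h k (Y, Y))\<^sup>2) = 0" for Y
    using F[of Y Y] by simp
  then have h0: "h k (Y, Y) = 0" for k Y
    by (cases "k < N") (simp_all add: sum_nonneg_eq_0_iff h_def)
  obtain D where D: "\<And>k z. (h k has_derivative D k z) (at z)"
    "\<And>k w. real_polynomial_function (\<lambda>z. D k z w)"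
    using real_polynomial_function_has_derivative[OF h] by metis
  \<comment> \<open>Because \<open>h k\<close> vanishes at \<open>(Y, Y)\<close>, this is a
    difference quotient.\<close>
  have lim: "((\<lambda>t. h k (Y + t *\<^sub>R V, Y) / t) \<longlongrightarrow> D k (Y, Y) (V, 0)) (at 0)" for k Y V
  proof -
    have "((\<lambda>t. (Y + t *\<^sub>R V, Y)) has_derivative (\<lambda>t. (t *\<^sub>R V, 0))) (at 0)"
      by (auto intro!: derivative_eq_intros)
    from has_derivative_compose[OF this, of "h k" "D k (Y, Y)"] D(1)
    have "((\<lambda>t. h k (Y + t *\<^sub>R V, Y)) has_derivative (\<lambda>t. D k (Y, Y) (t *\<^sub>R (V, 0)))) (at 0)"
      by simp
    then have "((\<lambda>t. h k (Y + t *\<^sub>R V, Y)) has_real_derivative D k (Y, Y) (V, 0)) (at 0)"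
      unfolding linear_scale[OF has_derivative_linear[OF D(1)]] has_field_derivative_def
      by (simp add: mult.commute[of _ "D k (Y, Y) (V, 0)"])
    then show ?thesis unfolding DERIV_def by (simp add: h0)
  qed
  show ?thesis
  proof (rule that[of "\<lambda>k Y V. D k (Y, Y) (V, 0)" N])
    fix k Y
    have "linear (\<lambda>V. D k (Y, Y) (V, 0))"
      using linear_compose[OF _ has_derivative_linear[OF D(1)], of "\<lambda>V. (V, 0)" k "(Y, Y)"]
      by (simp add: o_def linear_iff)
    then show "linear (\<lambda>V. D k (Y, Y) (V, 0))" .
  next
    fix k V
    have "polynomial_function (\<lambda>Y :: real ^ 'n::{finite,linorder} ^ 'm::{finite,linorder}. (Y, Y))"
      by (intro polynomial_function_bounded_linear bounded_linear_Pair bounded_linear_ident)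
    from real_polynomial_function_compose[OF this D(2)]
    show "real_polynomial_function (\<lambda>Y. D k (Y, Y) (V, 0))" by (simp add: o_def)
  next
    fix Y V :: "real ^ 'n::{finite,linorder} ^ 'm::{finite,linorder}" and \<phi>
    assume V: "in_line V" and \<phi>: "isCont \<phi> 0"
      and diff: "\<And>t. f (Y + t *\<^sub>R V) + f (Y - t *\<^sub>R V) - 2 * f Y = t\<^sup>2 * \<phi> t"
    have eq: "\<phi> t = (\<Sum>k<N. (h k (Y + t *\<^sub>R V, Y) / t)\<^sup>2) + (\<Sum>k<N. (h k (Y + t *\<^sub>R (- V), Y) / t)\<^sup>2)"
      if "t \<noteq> 0" for t
    proof -
      \<comment> \<open>This removes the unknown \<open>q\<close>. The representation, used at
        \<open>Y + t *\<^sub>R V\<close> and at \<open>Y - t *\<^sub>R V\<close>, leaves two sums of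
        squares; both have the same limit, whence the factor 1/2 in the conclusion.\<close>
      have "minors (Y + t *\<^sub>R V) + minors (Y - t *\<^sub>R V) = 2 *\<^sub>R minors Y"
        by (intro minors_second_difference in_line_scaleR V)
      then have "q Y \<bullet> (minors (Y + t *\<^sub>R V) - minors Y) + q Y \<bullet> (minors (Y - t *\<^sub>R V) - minors Y) = 0"
        by (simp add: inner_add_right[symmetric] scaleR_2 algebra_simps)
      then have "t\<^sup>2 * \<phi> t = (\<Sum>k<N. (h k (Y + t *\<^sub>R V, Y))\<^sup>2) + (\<Sum>k<N. (h k (Y + t *\<^sub>R (- V), Y))\<^sup>2)"
        using F[of "Y + t *\<^sub>R V" Y] F[of "Y - t *\<^sub>R V" Y] diff[of t] by simp
      then have "\<phi> t = ((\<Sum>k<N. (h k (Y + t *\<^sub>R V, Y))\<^sup>2) + (\<Sum>k<N. (h k (Y + t *\<^sub>R (- V), Y))\<^sup>2)) / t\<^sup>2"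
        using that by (simp add: field_simps)
      then show ?thesis by (simp add: add_divide_distrib sum_divide_distrib power_divide)
    qed
    have neg: "D k (Y, Y) (- V, 0) = - D k (Y, Y) (V, 0)" for k
      using linear_neg[OF has_derivative_linear[OF D(1)], of k "(Y, Y)" "(V, 0)"] by simp
    have "((\<lambda>t. (\<Sum>k<N. (h k (Y + t *\<^sub>R V, Y) / t)\<^sup>2) + (\<Sum>k<N. (h k (Y + t *\<^sub>R (- V), Y) / t)\<^sup>2))
      \<longlongrightarrow> (\<Sum>k<N. (D k (Y, Y) (V, 0))\<^sup>2) + (\<Sum>k<N. (D k (Y, Y) (- V, 0))\<^sup>2)) (at 0)"
      by (intro tendsto_add tendsto_sum tendsto_power lim)
    moreover have "\<forall>\<^sub>F t in at 0. (\<Sum>k<N. (h k (Y + t *\<^sub>R V, Y) / t)\<^sup>2)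
        + (\<Sum>k<N. (h k (Y + t *\<^sub>R (- V), Y) / t)\<^sup>2) = \<phi> t"
      using eq by (simp add: eventually_at_filter)
    ultimately have "(\<phi> \<longlongrightarrow> 2 * (\<Sum>k<N. (D k (Y, Y) (V, 0))\<^sup>2)) (at 0)"
      using Lim_transform_eventually by (fastforce simp: neg)
    moreover have "(\<phi> \<longlongrightarrow> \<phi> 0) (at 0)" using \<phi> by (simp add: isCont_def)
    ultimately have "2 * (\<Sum>k<N. (D k (Y, Y) (V, 0))\<^sup>2) = \<phi> 0"
      using tendsto_unique[OF at_neq_bot] by blast
    then show "(\<Sum>k<N. (D k (Y, Y) (V, 0))\<^sup>2) = \<phi> 0 / 2" by simp
  qed
qed


section \<open>Convexity\<close>

text \<open>Convexity is a statement about lines, so explicit formulas for directional derivatives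
  along lines suffice.\<close>

lemma convex_on_UNIV_second_derivative:
  fixes G :: "'a::real_vector \<Rightarrow> real"
  assumes G1: "\<And>z w t. ((\<lambda>t. G (z + t *\<^sub>R w)) has_real_derivative G1 (z + t *\<^sub>R w) w) (at t)"
    and G2: "\<And>z w t. ((\<lambda>t. G1 (z + t *\<^sub>R w) w) has_real_derivative G2 (z + t *\<^sub>R w) w) (at t)"
    and "\<And>z w. G2 z w \<ge> 0"
  shows "convex_on UNIV G"
proof (rule convex_onI)
  fix t :: real and x y :: 'a
  assume t: "0 < t" "t < 1"
  have "convex_on UNIV (\<lambda>t. G (x + t *\<^sub>R (y - x)))"
    by (rule f''_ge0_imp_convex[OF convex_UNIV G1 G2 assms(3)])
  from convex_onD[OF this, of t 0 1] t
  show "G ((1 - t) *\<^sub>R x + t *\<^sub>R y) \<le> (1 - t) * G x + t * G y"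
    by (simp add: algebra_simps)
qed simp

lemma has_real_derivative_linear_line:
  assumes "linear l"
  shows "((\<lambda>t. l (z + t *\<^sub>R w)) has_real_derivative l w) (at t)"
  unfolding linear_add[OF assms] linear_scale[OF assms]
  by (auto intro!: derivative_eq_intros)

lemma convex_on_linear_power_even:
  assumes "linear l" "even n"
  shows "convex_on UNIV (\<lambda>z. l z ^ n :: real)"
proof -
  have "convex_on UNIV (\<lambda>x :: real. x ^ n)" by (rule convex_power_even[OF assms(2)])
  then show ?thesis
    unfolding convex_on_def using assms(1) by (simp add: linear_add linear_scale)
qed

lemma convex_on_linear:
  assumes "linear (l :: 'a::real_vector \<Rightarrow> real)"
  shows "convex_on UNIV l"
  unfolding convex_on_def using assms by (simp add: linear_add linear_scale)

subsection \<open>The quartic\<close>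

text \<open>Choi's biquadratic form: expanded, it is the sum of all
  \<open>xi\<^sup>2 * yi\<^sup>2\<close>, minus \<open>2 * xi * xj * yi * yj\<close> for i < j, plus
  \<open>2 * (x1\<^sup>2 * y2\<^sup>2 + x2\<^sup>2 * y3\<^sup>2 + x3\<^sup>2 * y1\<^sup>2)\<close>.
  Written as a weighted sum of squares minus one square it is ready for the Cauchy-Schwarz
  inequality.\<close>

definition choi :: "real \<Rightarrow> real \<Rightarrow> real \<Rightarrow> real \<Rightarrow> real \<Rightarrow> real \<Rightarrow> real"
  where "choi x1 x2 x3 y1 y2 y3 =
    2 * ((x1\<^sup>2 + x3\<^sup>2) * y1\<^sup>2 + (x2\<^sup>2 + x1\<^sup>2) * y2\<^sup>2 + (x3\<^sup>2 + x2\<^sup>2) * y3\<^sup>2)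
    - (x1 * y1 + x2 * y2 + x3 * y3)\<^sup>2"

lemma weighted_Cauchy_Schwarz3:
  fixes y1 y2 y3 c1 c2 c3 :: real
  assumes "A1 \<ge> 0" "A2 \<ge> 0" "A3 \<ge> 0"
  shows "(A1 * y1 * c1 + A2 * y2 * c2 + A3 * y3 * c3)\<^sup>2 \<le>
    (A1 * y1\<^sup>2 + A2 * y2\<^sup>2 + A3 * y3\<^sup>2) * (A1 * c1\<^sup>2 + A2 * c2\<^sup>2 + A3 * c3\<^sup>2)"
proof -
  have "(A1 * y1\<^sup>2 + A2 * y2\<^sup>2 + A3 * y3\<^sup>2) * (A1 * c1\<^sup>2 + A2 * c2\<^sup>2 + A3 * c3\<^sup>2)
      - (A1 * y1 * c1 + A2 * y2 * c2 + A3 * y3 * c3)\<^sup>2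
    = A1 * A2 * (y1 * c2 - y2 * c1)\<^sup>2 + A1 * A3 * (y1 * c3 - y3 * c1)\<^sup>2
      + A2 * A3 * (y2 * c3 - y3 * c2)\<^sup>2"
    by (simp add: power2_eq_square algebra_simps)
  moreover have "0 \<le> A1 * A2 * (y1 * c2 - y2 * c1)\<^sup>2 + A1 * A3 * (y1 * c3 - y3 * c1)\<^sup>2
      + A2 * A3 * (y2 * c3 - y3 * c2)\<^sup>2"
    using assms by simp
  ultimately show ?thesis by linarith
qed

text \<open>Let \<open>Ai\<close> be the weight of \<open>yi\<^sup>2\<close>. Cauchy-Schwarz with
  these weights and \<open>ci = xi / Ai\<close> bounds the subtracted square by the weighted sum
  times the sum of all \<open>xi\<^sup>2 / Ai\<close>, and the latter sum is at most 2.\<close>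

lemma choi_nonneg: "choi x1 x2 x3 y1 y2 y3 \<ge> 0"
proof -
  define A1 A2 A3 where A: "A1 = x1\<^sup>2 + x3\<^sup>2" "A2 = x2\<^sup>2 + x1\<^sup>2" "A3 = x3\<^sup>2 + x2\<^sup>2"
  have nonneg: "A1 \<ge> 0" "A2 \<ge> 0" "A3 \<ge> 0" by (auto simp: A)
  show ?thesis
  proof (cases "A1 = 0 \<or> A2 = 0 \<or> A3 = 0")
    case True
    \<comment> \<open>A vanishing weight forces two of the \<open>xi\<close> to vanish, and the form
      is then visibly nonnegative.\<close>
    then consider "x1 = 0" "x3 = 0" | "x1 = 0" "x2 = 0" | "x2 = 0" "x3 = 0"
      unfolding A by (auto simp: sum_power2_eq_zero_iff)
    then show ?thesis
      by cases (simp_all add: choi_def power_mult_distrib algebra_simps)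
  next
    case False
    then have pos: "A1 > 0" "A2 > 0" "A3 > 0" using nonneg by auto
    define S where "S = x1\<^sup>2 + x2\<^sup>2 + x3\<^sup>2"
    have S: "S > 0" using pos by (auto simp: A S_def)
    \<comment> \<open>Adding \<open>q\<close> to numerator and denominator of a fraction at most 1
      increases it. This gives the three fractions the common denominator \<open>S\<close>, and
      their numerators add up to \<open>2 * S\<close>.\<close>
    have bound: "p / (p + r) \<le> (p + q) / (p + q + r)"
      if "p + r > 0" "p \<ge> 0" "q \<ge> 0" "r \<ge> 0" for p q r :: real
      using that by (simp add: divide_simps) (simp add: algebra_simps)
    have "x1\<^sup>2 / A1 \<le> (x1\<^sup>2 + x2\<^sup>2) / S" "x2\<^sup>2 / A2 \<le> (x2\<^sup>2 + x3\<^sup>2) / S" "x3\<^sup>2 / A3 \<le> (x3\<^sup>2 + x1\<^sup>2) / S"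
      using bound[of "x1\<^sup>2" "x3\<^sup>2" "x2\<^sup>2"] bound[of "x2\<^sup>2" "x1\<^sup>2" "x3\<^sup>2"] bound[of "x3\<^sup>2" "x2\<^sup>2" "x1\<^sup>2"] pos
      unfolding A S_def by (simp_all add: add_ac)
    then have "x1\<^sup>2 / A1 + x2\<^sup>2 / A2 + x3\<^sup>2 / A3
        \<le> (x1\<^sup>2 + x2\<^sup>2) / S + (x2\<^sup>2 + x3\<^sup>2) / S + (x3\<^sup>2 + x1\<^sup>2) / S" by linarith
    also have "\<dots> = 2 * S / S"
      unfolding add_divide_distrib[symmetric] by (rule arg_cong[where f = "\<lambda>x. x / S"]) (simp add: S_def)
    finally have le2: "x1\<^sup>2 / A1 + x2\<^sup>2 / A2 + x3\<^sup>2 / A3 \<le> 2" using S by simp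
    have "(x1 * y1 + x2 * y2 + x3 * y3)\<^sup>2 \<le> (A1 * y1\<^sup>2 + A2 * y2\<^sup>2 + A3 * y3\<^sup>2)
        * (A1 * (x1 / A1)\<^sup>2 + A2 * (x2 / A2)\<^sup>2 + A3 * (x3 / A3)\<^sup>2)"
      using weighted_Cauchy_Schwarz3[OF nonneg, of y1 "x1 / A1" y2 "x2 / A2" y3 "x3 / A3"] pos
      by (simp add: mult.commute)
    also have "A1 * (x1 / A1)\<^sup>2 + A2 * (x2 / A2)\<^sup>2 + A3 * (x3 / A3)\<^sup>2 = x1\<^sup>2 / A1 + x2\<^sup>2 / A2 + x3\<^sup>2 / A3"
      using pos by (simp add: power2_eq_square)
    also have "(A1 * y1\<^sup>2 + A2 * y2\<^sup>2 + A3 * y3\<^sup>2) * \<dots> \<le> (A1 * y1\<^sup>2 + A2 * y2\<^sup>2 + A3 * y3\<^sup>2) * 2"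
      using nonneg by (intro mult_left_mono[OF le2]) simp
    finally show ?thesis unfolding choi_def A by simp
  qed
qed

text \<open>The square of the norm of x is constant in y, and that of y is flat to order four at y =
  0. The second derivative in y at y = 0 is therefore still twice \<open>choi\<close>, while the
  added terms make the function convex.\<close>

definition quartic :: "real \<Rightarrow> real \<Rightarrow> real \<Rightarrow> real \<Rightarrow> real \<Rightarrow> real \<Rightarrow> real"
  where "quartic x1 x2 x3 y1 y2 y3 = choi x1 x2 x3 y1 y2 y3
    + 4 * ((x1\<^sup>2 + x2\<^sup>2 + x3\<^sup>2)\<^sup>2 + (y1\<^sup>2 + y2\<^sup>2 + y3\<^sup>2)\<^sup>2)"

definition quartic_deriv where
  "quartic_deriv x1 x2 x3 y1 y2 y3 u1 u2 u3 v1 v2 v3 =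
    2 * ((2 * x1 * u1 + 2 * x3 * u3) * y1\<^sup>2 + (x1\<^sup>2 + x3\<^sup>2) * (2 * y1 * v1)
      + (2 * x2 * u2 + 2 * x1 * u1) * y2\<^sup>2 + (x2\<^sup>2 + x1\<^sup>2) * (2 * y2 * v2)
      + (2 * x3 * u3 + 2 * x2 * u2) * y3\<^sup>2 + (x3\<^sup>2 + x2\<^sup>2) * (2 * y3 * v3))
    - 2 * (x1 * y1 + x2 * y2 + x3 * y3)
      * (u1 * y1 + x1 * v1 + (u2 * y2 + x2 * v2) + (u3 * y3 + x3 * v3))
    + 16 * ((x1\<^sup>2 + x2\<^sup>2 + x3\<^sup>2) * (x1 * u1 + x2 * u2 + x3 * u3)
      + (y1\<^sup>2 + y2\<^sup>2 + y3\<^sup>2) * (y1 * v1 + y2 * v2 + y3 * v3 :: real))"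

definition quartic_deriv2 where
  "quartic_deriv2 x1 x2 x3 y1 y2 y3 u1 u2 u3 v1 v2 v3 =
    2 * ((2 * u1\<^sup>2 + 2 * u3\<^sup>2) * y1\<^sup>2 + 2 * (2 * x1 * u1 + 2 * x3 * u3) * (2 * y1 * v1) + (x1\<^sup>2 + x3\<^sup>2) * (2 * v1\<^sup>2)
      + (2 * u2\<^sup>2 + 2 * u1\<^sup>2) * y2\<^sup>2 + 2 * (2 * x2 * u2 + 2 * x1 * u1) * (2 * y2 * v2) + (x2\<^sup>2 + x1\<^sup>2) * (2 * v2\<^sup>2)
      + (2 * u3\<^sup>2 + 2 * u2\<^sup>2) * y3\<^sup>2 + 2 * (2 * x3 * u3 + 2 * x2 * u2) * (2 * y3 * v3) + (x3\<^sup>2 + x2\<^sup>2) * (2 * v3\<^sup>2))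
    - 2 * (u1 * y1 + x1 * v1 + (u2 * y2 + x2 * v2) + (u3 * y3 + x3 * v3))\<^sup>2
    - 4 * (x1 * y1 + x2 * y2 + x3 * y3) * (u1 * v1 + u2 * v2 + u3 * v3)
    + 16 * (2 * (x1 * u1 + x2 * u2 + x3 * u3)\<^sup>2 + (x1\<^sup>2 + x2\<^sup>2 + x3\<^sup>2) * (u1\<^sup>2 + u2\<^sup>2 + u3\<^sup>2)
      + 2 * (y1 * v1 + y2 * v2 + y3 * v3)\<^sup>2 + (y1\<^sup>2 + y2\<^sup>2 + y3\<^sup>2) * (v1\<^sup>2 + v2\<^sup>2 + v3\<^sup>2 :: real))"

lemma quartic_has_derivative:
  assumes "(x1 has_real_derivative u1) (at t)" "(x2 has_real_derivative u2) (at t)"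
    "(x3 has_real_derivative u3) (at t)" "(y1 has_real_derivative v1) (at t)"
    "(y2 has_real_derivative v2) (at t)" "(y3 has_real_derivative v3) (at t)"
  shows "((\<lambda>t. quartic (x1 t) (x2 t) (x3 t) (y1 t) (y2 t) (y3 t)) has_real_derivative
      quartic_deriv (x1 t) (x2 t) (x3 t) (y1 t) (y2 t) (y3 t) u1 u2 u3 v1 v2 v3) (at t)"
    and "((\<lambda>t. quartic_deriv (x1 t) (x2 t) (x3 t) (y1 t) (y2 t) (y3 t) u1 u2 u3 v1 v2 v3) has_real_derivative
      quartic_deriv2 (x1 t) (x2 t) (x3 t) (y1 t) (y2 t) (y3 t) u1 u2 u3 v1 v2 v3) (at t)"
  unfolding quartic_def choi_def quartic_deriv_def
   apply (rule derivative_eq_intros assms refl)+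
   apply (simp add: power2_eq_square algebra_simps)
  apply (rule derivative_eq_intros assms refl)+
  apply (simp add: quartic_deriv2_def power2_eq_square algebra_simps)
  done

text \<open>A certificate of nonnegativity. The two values of \<open>choi\<close> are the parts of
  its Hessian that are quadratic in u alone or in v alone. The mixed terms are completed to squares
  at the expense of the Hessian of the added quartic terms.\<close>

lemma quartic_deriv2_eq:
  "quartic_deriv2 x1 x2 x3 y1 y2 y3 u1 u2 u3 v1 v2 v3 =
    2 * choi u1 u2 u3 y1 y2 y3 + 2 * choi x1 x2 x3 v1 v2 v3
    + 4 * ((x1 * u1 + y1 * v1)\<^sup>2 + (x2 * u2 + y2 * v2)\<^sup>2 + (x3 * u3 + y3 * v3)\<^sup>2)
    + 8 * ((x1 * u1 + y2 * v2)\<^sup>2 + (x2 * u2 + y3 * v3)\<^sup>2 + (x3 * u3 + y1 * v1)\<^sup>2)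
    + 2 * ((u1 * x2 + x1 * u2 - v1 * y2 - y1 * v2)\<^sup>2 + (u2 * x3 + x2 * u3 - v2 * y3 - y2 * v3)\<^sup>2
      + (u3 * x1 + x3 * u1 - v3 * y1 - y3 * v1)\<^sup>2)
    + 2 * ((u1 * x2 - x1 * u2)\<^sup>2 + (u2 * x3 - x2 * u3)\<^sup>2 + (u3 * x1 - x3 * u1)\<^sup>2)
    + 2 * ((v1 * y2 - y1 * v2)\<^sup>2 + (v2 * y3 - y2 * v3)\<^sup>2 + (v3 * y1 - y3 * v1)\<^sup>2)
    + 32 * ((x1 * u1 + x2 * u2 + x3 * u3)\<^sup>2 + (y1 * v1 + y2 * v2 + y3 * v3)\<^sup>2)
    + 4 * ((x1 * u1)\<^sup>2 + (x2 * u2)\<^sup>2 + (x3 * u3)\<^sup>2 + (y1 * v1)\<^sup>2 + (y2 * v2)\<^sup>2 + (y3 * v3)\<^sup>2)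
    + 12 * ((x1 * u2)\<^sup>2 + (x1 * u3)\<^sup>2 + (x2 * u1)\<^sup>2 + (x2 * u3)\<^sup>2 + (x3 * u1)\<^sup>2 + (x3 * u2)\<^sup>2)
    + 12 * ((y1 * v2)\<^sup>2 + (y1 * v3)\<^sup>2 + (y2 * v1)\<^sup>2 + (y2 * v3)\<^sup>2 + (y3 * v1)\<^sup>2 + (y3 * v2)\<^sup>2)"
  unfolding quartic_deriv2_def choi_def by (simp add: power2_eq_square algebra_simps)

lemma convex_on_quartic:
  assumes "linear x1" "linear x2" "linear x3" "linear y1" "linear y2" "linear y3"
  shows "convex_on UNIV (\<lambda>z :: 'a::real_vector. quartic (x1 z) (x2 z) (x3 z) (y1 z) (y2 z) (y3 z))"
  by (rule convex_on_UNIV_second_derivative)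
    (rule quartic_has_derivative has_real_derivative_linear_line assms
      | simp add: quartic_deriv2_eq choi_nonneg)+

subsection \<open>The sextic\<close>

text \<open>Quadratic in \<open>(p, q)\<close>, but of degree four in \<open>(a, b)\<close>. At
  \<open>p = 1\<close> it is the Choi-Lam form
  \<open>w^4 + x^2 y^2 + y^2 z^2 + z^2 x^2 - 4 x y z w\<close> with w = 1, x = a, y = b, z =
  q.\<close>

definition biquadratic :: "real \<Rightarrow> real \<Rightarrow> real \<Rightarrow> real \<Rightarrow> real"
  where "biquadratic a b p q = p\<^sup>2 * (1 + (a * b)\<^sup>2) + q\<^sup>2 * (a\<^sup>2 + b\<^sup>2) - 4 * (a * b) * (p * q)"

text \<open>This is the inequality of arithmetic and geometric means for four terms. The two
  rewritings differ in the sign of the term with factor \<open>a * b\<close>, and one of them suits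
  the sign of \<open>a * b\<close>.\<close>

lemma biquadratic_nonneg: "biquadratic a b p q \<ge> 0"
proof -
  have "biquadratic a b p q = (p - a * b * p)\<^sup>2 + q\<^sup>2 * (a - b)\<^sup>2 + 2 * (a * b) * (p - q)\<^sup>2"
    unfolding biquadratic_def by (simp add: power2_eq_square algebra_simps)
  moreover have "biquadratic a b p q = (p + a * b * p)\<^sup>2 + q\<^sup>2 * (a + b)\<^sup>2 - 2 * (a * b) * (p + q)\<^sup>2"
    unfolding biquadratic_def by (simp add: power2_eq_square algebra_simps)
  moreover have "0 \<le> 2 * (a * b) * (p - q)\<^sup>2 \<or> 2 * (a * b) * (p + q)\<^sup>2 \<le> 0"
    by (metis linear mult_nonneg_nonneg mult_nonpos_nonneg zero_le_power2)
  moreover have "0 \<le> (p - a * b * p)\<^sup>2 + q\<^sup>2 * (a - b)\<^sup>2" "0 \<le> (p + a * b * p)\<^sup>2 + q\<^sup>2 * (a + b)\<^sup>2"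
    by simp_all
  ultimately show ?thesis by linarith
qed

text \<open>The added terms are either constant in \<open>(p, q)\<close> or of order at least four
  there, so the second derivative in \<open>(p, q)\<close> at 0 is twice \<open>biquadratic\<close>.
  Their weights are large enough for the estimate in \<open>sextic_deriv2_nonneg\<close>.\<close>

definition sextic :: "real \<Rightarrow> real \<Rightarrow> real \<Rightarrow> real \<Rightarrow> real"
  where "sextic a b p q = biquadratic a b p q + 3 * (a\<^sup>2 + b\<^sup>2) + 5 * (a\<^sup>2 + b\<^sup>2) ^ 3
    + 2 * (p\<^sup>2 + q\<^sup>2)\<^sup>2 + (a\<^sup>2 + b\<^sup>2) * (p\<^sup>2 + q\<^sup>2)\<^sup>2 + 2 * (p\<^sup>2 + q\<^sup>2) ^ 3"

definition sextic_deriv where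
  "sextic_deriv a b p q u1 u2 v1 v2 =
    2 * p * v1 * (1 + (a * b)\<^sup>2) + p\<^sup>2 * (2 * (a * b) * (b * u1 + a * u2))
    + 2 * q * v2 * (a\<^sup>2 + b\<^sup>2) + q\<^sup>2 * (2 * (a * u1 + b * u2))
    - 4 * (b * u1 + a * u2) * (p * q) - 4 * (a * b) * (v1 * q + p * v2)
    + 6 * (a * u1 + b * u2) + 30 * (a\<^sup>2 + b\<^sup>2)\<^sup>2 * (a * u1 + b * u2)
    + 8 * (p\<^sup>2 + q\<^sup>2) * (p * v1 + q * v2)
    + 2 * (a * u1 + b * u2) * (p\<^sup>2 + q\<^sup>2)\<^sup>2 + 4 * (a\<^sup>2 + b\<^sup>2) * (p\<^sup>2 + q\<^sup>2) * (p * v1 + q * v2)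
    + 12 * (p\<^sup>2 + q\<^sup>2)\<^sup>2 * (p * v1 + q * v2 :: real)"

definition sextic_deriv2 where
  "sextic_deriv2 a b p q u1 u2 v1 v2 =
   (let A = a\<^sup>2 + b\<^sup>2; P = p\<^sup>2 + q\<^sup>2; U = u1\<^sup>2 + u2\<^sup>2; V = v1\<^sup>2 + v2\<^sup>2;
        s = a * u1 + b * u2; w = b * u1 + a * u2; r = p * v1 + q * v2; x = v1 * q + p * v2
    in 2 * biquadratic a b v1 v2
      + p\<^sup>2 * (2 * w\<^sup>2 + 4 * (a * b) * (u1 * u2)) + 2 * q\<^sup>2 * U - 8 * (p * q) * (u1 * u2)
      + 8 * (p * v1) * (a * b) * w + 8 * (q * v2) * s - 8 * x * w
      + 6 * U + 30 * A\<^sup>2 * U + 120 * A * s\<^sup>2 + 8 * P * V + 16 * r\<^sup>2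
      + 2 * U * P\<^sup>2 + 16 * s * P * r + 4 * A * P * V + 8 * A * r\<^sup>2
      + 12 * P\<^sup>2 * V + 48 * P * (r\<^sup>2 :: real))"

lemma sextic_has_derivative:
  assumes "(a has_real_derivative u1) (at t)" "(b has_real_derivative u2) (at t)"
    "(p has_real_derivative v1) (at t)" "(q has_real_derivative v2) (at t)"
  shows "((\<lambda>t. sextic (a t) (b t) (p t) (q t)) has_real_derivative
      sextic_deriv (a t) (b t) (p t) (q t) u1 u2 v1 v2) (at t)"
    and "((\<lambda>t. sextic_deriv (a t) (b t) (p t) (q t) u1 u2 v1 v2) has_real_derivative
      sextic_deriv2 (a t) (b t) (p t) (q t) u1 u2 v1 v2) (at t)"
  unfolding sextic_def biquadratic_def sextic_deriv_def
   apply (rule derivative_eq_intros assms refl)+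
   apply (simp add: power2_eq_square power3_eq_cube algebra_simps)
  apply (rule derivative_eq_intros assms refl)+
  apply (simp add: sextic_deriv2_def biquadratic_def Let_def power2_eq_square algebra_simps)
  done

text \<open>One part is \<open>2 * biquadratic a b v1 v2\<close>. The inequalities of Young and
  Cauchy-Schwarz bound each other term of indefinite sign (\<open>e1\<close> to \<open>e6\<close>)
  by products of \<open>A\<close>, \<open>P\<close> with \<open>U\<close> or \<open>V\<close>, which
  the second derivatives of the added terms absorb.\<close>

lemma sextic_deriv2_nonneg: "sextic_deriv2 a b p q u1 u2 v1 v2 \<ge> 0"
proof -
  define A P U V s w r x where d: "A = a\<^sup>2 + b\<^sup>2" "P = p\<^sup>2 + q\<^sup>2" "U = u1\<^sup>2 + u2\<^sup>2" "V = v1\<^sup>2 + v2\<^sup>2"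
    "s = a * u1 + b * u2" "w = b * u1 + a * u2" "r = p * v1 + q * v2" "x = v1 * q + p * v2"
  note nonneg = sum_power2_ge_zero[of a b, folded d] sum_power2_ge_zero[of p q, folded d]
    sum_power2_ge_zero[of u1 u2, folded d] sum_power2_ge_zero[of v1 v2, folded d]
  have young: "- (y\<^sup>2 + z\<^sup>2) \<le> 2 * y * z" for y z :: real
    using zero_le_power2[of "y + z"] by (simp add: power2_eq_square algebra_simps)
  have cs: "(a1 * b1 + a2 * b2)\<^sup>2 \<le> (a1\<^sup>2 + a2\<^sup>2) * (b1\<^sup>2 + b2\<^sup>2)" for a1 a2 b1 b2 :: real
    using zero_le_power2[of "a1 * b2 - a2 * b1"] by (simp add: power2_eq_square algebra_simps)
  have s: "s\<^sup>2 \<le> A * U" and w: "w\<^sup>2 \<le> A * U" and r: "r\<^sup>2 \<le> P * V" and x: "x\<^sup>2 \<le> P * V"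
    using cs[of a u1 b u2] cs[of b u1 a u2] cs[of p v1 q v2] cs[of q v1 p v2]
    unfolding d by (simp_all add: add.commute mult.commute)
  have ab: "\<bar>2 * (a * b)\<bar> \<le> A" and u: "\<bar>2 * (u1 * u2)\<bar> \<le> U" and pq: "\<bar>2 * (p * q)\<bar> \<le> P"
    using sum_squares_bound[of a b] sum_squares_bound[of u1 u2] sum_squares_bound[of p q]
      young[of a b] young[of u1 u2] young[of p q]
    unfolding d by (auto simp: abs_le_iff)
  have split: "\<bar>4 * y * z\<bar> = \<bar>2 * y\<bar> * \<bar>2 * z\<bar>" for y z :: real
    by (simp add: abs_mult)
  have "\<bar>4 * (a * b) * (u1 * u2)\<bar> \<le> A * U"
    unfolding split by (rule mult_mono[OF ab u nonneg(1) abs_ge_zero])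
  then have "p\<^sup>2 * - (4 * (a * b) * (u1 * u2)) \<le> p\<^sup>2 * (A * U)"
    by (intro mult_left_mono) (auto simp only: abs_le_iff zero_le_power2)
  also have "\<dots> \<le> P * (A * U)"
    using nonneg by (intro mult_right_mono) (simp_all add: d(2))
  finally have e1: "p\<^sup>2 * (4 * (a * b) * (u1 * u2)) \<ge> - (P * (A * U))"
    by simp
  have "\<bar>4 * (p * q) * (u1 * u2)\<bar> \<le> P * U"
    unfolding split by (rule mult_mono[OF pq u nonneg(2) abs_ge_zero])
  then have e2: "- 8 * (p * q) * (u1 * u2) \<ge> - 2 * (P * U)"
    unfolding abs_le_iff by linarith
  have pv: "(p * v1)\<^sup>2 \<le> P * V" and qv: "(q * v2)\<^sup>2 \<le> P * V"
    unfolding d power_mult_distrib by (intro mult_mono; simp)+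
  have "a\<^sup>2 * (p * v1)\<^sup>2 \<le> A * (P * V)" "b\<^sup>2 * w\<^sup>2 \<le> A * (A * U)"
    using nonneg by (intro mult_mono pv w; simp add: d)+
  then have e3: "8 * (p * v1) * (a * b) * w \<ge> - 4 * (A * (P * V) + A * (A * U))"
    using young[of "a * (p * v1)" "b * w"] by (simp add: power_mult_distrib algebra_simps)
  have e4: "8 * (q * v2) * s \<ge> - 4 * (P * V + A * U)"
    using young[of "q * v2" s] qv s by (simp add: algebra_simps)
  have e5: "- 8 * x * w \<ge> - 4 * (P * V + A * U)"
    using sum_squares_bound[of x w] x w by (simp add: algebra_simps)
  have "P * s\<^sup>2 \<le> P * (A * U)" "P * r\<^sup>2 \<le> P * (P * V)"
    using nonneg by (intro mult_left_mono s r; simp)+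
  moreover have "- (P * (s\<^sup>2 + r\<^sup>2)) \<le> P * (2 * s * r)"
    using mult_left_mono[OF young[of s r] nonneg(2)] by (simp only: mult_minus_right)
  ultimately have e6: "16 * s * P * r \<ge> - 8 * (P * (A * U) + P * (P * V))"
    by (simp add: algebra_simps)
  \<comment> \<open>This is the coefficient of \<open>U\<close> that remains after all six estimates
    have been paid for; the one of \<open>V\<close> is \<open>4 * P\<^sup>2\<close>.\<close>
  have "6 + 26 * A\<^sup>2 + 2 * P\<^sup>2 - 9 * A * P - 2 * P - 8 * A =
      (P - 9 / 2 * A)\<^sup>2 + (P - 1)\<^sup>2 + 7 / 4 * A\<^sup>2 + (2 * A - 2)\<^sup>2 + 1"
    by (simp add: power2_eq_square algebra_simps)
  also have "\<dots> \<ge> 0" by simp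
  finally have "0 \<le> U * (6 + 26 * A\<^sup>2 + 2 * P\<^sup>2 - 9 * A * P - 2 * P - 8 * A)"
    using nonneg by simp
  moreover have "0 \<le> P\<^sup>2 * V" "0 \<le> A * s\<^sup>2" "0 \<le> A * r\<^sup>2" "0 \<le> P * r\<^sup>2" "0 \<le> p\<^sup>2 * w\<^sup>2" "0 \<le> q\<^sup>2 * U" "0 \<le> r\<^sup>2"
    using nonneg by simp_all
  moreover have "sextic_deriv2 a b p q u1 u2 v1 v2 = 2 * biquadratic a b v1 v2
      + (p\<^sup>2 * (4 * (a * b) * (u1 * u2)) + P * (A * U))
      + (- 8 * (p * q) * (u1 * u2) + 2 * (P * U))
      + (8 * (p * v1) * (a * b) * w + 4 * (A * (P * V) + A * (A * U)))
      + (8 * (q * v2) * s + 4 * (P * V + A * U))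
      + (- 8 * x * w + 4 * (P * V + A * U))
      + (16 * s * P * r + 8 * (P * (A * U) + P * (P * V)))
      + U * (6 + 26 * A\<^sup>2 + 2 * P\<^sup>2 - 9 * A * P - 2 * P - 8 * A)
      + 4 * (P\<^sup>2 * V) + 120 * (A * s\<^sup>2) + 8 * (A * r\<^sup>2) + 48 * (P * r\<^sup>2)
      + 2 * (p\<^sup>2 * w\<^sup>2) + 2 * (q\<^sup>2 * U) + 16 * r\<^sup>2"
    unfolding sextic_deriv2_def Let_def d[symmetric]
    by (simp add: power2_eq_square algebra_simps)
  ultimately show ?thesis
    using e1 e2 e3 e4 e5 e6 biquadratic_nonneg[of a b v1 v2] by linarith
qed

lemma convex_on_sextic:
  assumes "linear a" "linear b" "linear p" "linear q"
  shows "convex_on UNIV (\<lambda>z :: 'a::real_vector. sextic (a z) (b z) (p z) (q z))"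
  by (rule convex_on_UNIV_second_derivative)
    (rule sextic_has_derivative has_real_derivative_linear_line assms sextic_deriv2_nonneg)+


section \<open>Forms that are not sums of squares\<close>

lemma real_polynomial_function_ray:
  assumes "real_polynomial_function p"
  shows "real_polynomial_function (\<lambda>t :: real. p (t *\<^sub>R x))"
  using real_polynomial_function_compose[OF polynomial_function_bounded_linear assms, of "\<lambda>t. t *\<^sub>R x"]
  by (simp add: o_def bounded_linear_scaleR_left)

lemma has_derivative_imp_ray:
  assumes "(p has_derivative D) (at 0)"
  shows "((\<lambda>t :: real. p (t *\<^sub>R x)) has_real_derivative D x) (at 0)"
proof -
  have "((\<lambda>t :: real. t *\<^sub>R x) has_derivative (\<lambda>t. t *\<^sub>R x)) (at 0)"
    by (auto intro!: derivative_eq_intros)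
  from has_derivative_compose[OF this, of p D] assms
  have "((\<lambda>t. p (t *\<^sub>R x)) has_derivative (\<lambda>t. D (t *\<^sub>R x))) (at 0)" by simp
  then show ?thesis
    unfolding linear_scale[OF has_derivative_linear[OF assms]] has_field_derivative_def
    by (simp add: mult.commute[of _ "D x"])
qed

lemma sum_squares_member_le:
  fixes g :: "nat \<Rightarrow> real"
  shows "k < N \<Longrightarrow> (g k)\<^sup>2 \<le> (\<Sum>k<N. (g k)\<^sup>2)"
  by (rule member_le_sum) auto

text \<open>Quadratic growth of the sum makes each \<open>L k\<close> linear in the point, so the
  squares are squares of bilinear forms. The three products on which \<open>choi\<close> vanishes
  cannot occur in them, and averaging over sign vectors then gives a negative sum of
  squares.\<close>

lemma choi_not_sum_of_squares:
  fixes L :: "nat \<Rightarrow> 'a::real_normed_vector \<Rightarrow> 'b::real_vector \<Rightarrow> real"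
  assumes lin: "\<And>k Y. linear (L k Y)" and poly: "\<And>k V. real_polynomial_function (\<lambda>Y. L k Y V)"
    and sq: "\<And>x1 x2 x3 v1 v2 v3.
      (\<Sum>k<N. (L k (x1 *\<^sub>R e1 + x2 *\<^sub>R e2 + x3 *\<^sub>R e3) (v1 *\<^sub>R f1 + v2 *\<^sub>R f2 + v3 *\<^sub>R f3))\<^sup>2)
        = choi x1 x2 x3 v1 v2 v3"
  shows False
proof -
  let ?Y = "\<lambda>x1 x2 x3. x1 *\<^sub>R e1 + x2 *\<^sub>R e2 + x3 *\<^sub>R e3"
  let ?V = "\<lambda>v1 v2 v3. v1 *\<^sub>R f1 + v2 *\<^sub>R f2 + v3 *\<^sub>R f3"
  have hom: "L k (t *\<^sub>R ?Y x1 x2 x3) (?V v1 v2 v3) = t * L k (?Y x1 x2 x3) (?V v1 v2 v3)"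
    if k: "k < N" for k t x1 x2 x3 v1 v2 v3
  proof -
    have "(L k (t *\<^sub>R ?Y x1 x2 x3) (?V v1 v2 v3))\<^sup>2 \<le> choi x1 x2 x3 v1 v2 v3 * t\<^sup>2" for t
    proof -
      have "choi (t * x1) (t * x2) (t * x3) v1 v2 v3 = choi x1 x2 x3 v1 v2 v3 * t\<^sup>2"
        by (simp add: choi_def power2_eq_square algebra_simps)
      then show ?thesis
        using sum_squares_member_le[OF k, of "\<lambda>k. L k (?Y (t * x1) (t * x2) (t * x3)) (?V v1 v2 v3)"]
        unfolding sq by (simp add: scaleR_add_right)
    qed
    from real_polynomial_function_linear_growth[OF real_polynomial_function_ray[OF poly] this]
    show ?thesis by simp
  qed
  \<comment> \<open>The value 0 for k \<ge> N makes the coefficients vanish without a bound on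
    \<open>k\<close>.\<close>
  define c where "c k e f = (if k < N then L k e f else 0)" for k e f
  have bilinear: "L k (?Y x1 x2 x3) (?V v1 v2 v3)
      = x1 * (v1 * c k e1 f1 + v2 * c k e1 f2 + v3 * c k e1 f3)
      + x2 * (v1 * c k e2 f1 + v2 * c k e2 f2 + v3 * c k e2 f3)
      + x3 * (v1 * c k e3 f1 + v2 * c k e3 f2 + v3 * c k e3 f3)"
    if k: "k < N" for k x1 x2 x3 v1 v2 v3
  proof -
    \<comment> \<open>A function that is homogeneous of degree one along a ray agrees there with its
      derivative at 0, and \<open>D\<close> is linear.\<close>
    define D where "D = frechet_derivative (\<lambda>Y. L k Y (?V v1 v2 v3)) (at 0)"
    have D: "((\<lambda>Y. L k Y (?V v1 v2 v3)) has_derivative D) (at 0)"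
      unfolding D_def frechet_derivative_works[symmetric]
      by (rule differentiable_at_real_polynomial_function[OF poly])
    have eq: "L k (?Y x1 x2 x3) (?V v1 v2 v3) = D (?Y x1 x2 x3)" for x1 x2 x3
    proof -
      have "((\<lambda>t. L k (t *\<^sub>R ?Y x1 x2 x3) (?V v1 v2 v3)) has_real_derivative
          L k (?Y x1 x2 x3) (?V v1 v2 v3)) (at 0)"
        unfolding hom[OF k] by (auto intro!: derivative_eq_intros)
      from DERIV_unique[OF this has_derivative_imp_ray[OF D]] show ?thesis .
    qed
    note linD = has_derivative_linear[OF D]
    have "D e1 = L k e1 (?V v1 v2 v3)" "D e2 = L k e2 (?V v1 v2 v3)" "D e3 = L k e3 (?V v1 v2 v3)"
      using eq[of 1 0 0] eq[of 0 1 0] eq[of 0 0 1] by simp_all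
    then have "L k (?Y x1 x2 x3) (?V v1 v2 v3) =
        x1 * L k e1 (?V v1 v2 v3) + x2 * L k e2 (?V v1 v2 v3) + x3 * L k e3 (?V v1 v2 v3)"
      unfolding eq by (simp add: linear_add[OF linD] linear_scale[OF linD])
    then show ?thesis
      using k by (simp add: c_def linear_add[OF lin] linear_scale[OF lin])
  qed
  have sq': "(\<Sum>k<N. (x1 * (v1 * c k e1 f1 + v2 * c k e1 f2 + v3 * c k e1 f3)
      + x2 * (v1 * c k e2 f1 + v2 * c k e2 f2 + v3 * c k e2 f3)
      + x3 * (v1 * c k e3 f1 + v2 * c k e3 f2 + v3 * c k e3 f3))\<^sup>2)
      = choi x1 x2 x3 v1 v2 v3" for x1 x2 x3 v1 v2 v3
    unfolding sq[symmetric] using bilinear by (intro sum.cong) auto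
  have vanish: "c k e f = 0" if "(\<Sum>k<N. (c k e f)\<^sup>2) = 0" for k e f
    using that by (cases "k < N") (auto simp: sum_nonneg_eq_0_iff c_def)
  \<comment> \<open>The variables of \<open>sq'\<close> are instantiated in the order x1, v1, v2,
    v3, x2, x3.\<close>
  have zero: "c k e1 f3 = 0" "c k e2 f1 = 0" "c k e3 f2 = 0" for k
    by (rule vanish, use sq'[of 1 0 0 1 0 0] sq'[of 0 1 0 0 1 0] sq'[of 0 0 1 0 0 1] in \<open>simp add: choi_def\<close>)+
  let ?a = "\<lambda>k. c k e1 f1" and ?b = "\<lambda>k. c k e2 f2" and ?d = "\<lambda>k. c k e3 f3"
  let ?x = "\<lambda>k. c k e1 f2" and ?y = "\<lambda>k. c k e2 f3" and ?z = "\<lambda>k. c k e3 f1"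
  have off: "(\<Sum>k<N. (?x k)\<^sup>2) = 2" "(\<Sum>k<N. (?y k)\<^sup>2) = 2" "(\<Sum>k<N. (?z k)\<^sup>2) = 2"
    using sq'[of 1 0 1 0 0 0] sq'[of 0 0 0 1 1 0] sq'[of 0 1 0 0 0 1] by (simp_all add: choi_def)
  \<comment> \<open>These are the four sign vectors up to a common sign, with v = x; there
    \<open>choi\<close> is 12 - 9 = 3.\<close>
  have signs: "(\<Sum>k<N. ((?a k + ?x k) + (?b k + ?y k) + (?z k + ?d k))\<^sup>2) = 3"
    "(\<Sum>k<N. ((?a k + ?x k) + (?b k - ?y k) + (?d k - ?z k))\<^sup>2) = 3"
    "(\<Sum>k<N. ((?a k - ?x k) + (?b k - ?y k) + (?z k + ?d k))\<^sup>2) = 3"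
    "(\<Sum>k<N. ((?a k - ?x k) + (?b k + ?y k) + (?d k - ?z k))\<^sup>2) = 3"
    using sq'[of 1 1 1 1 1 1] sq'[of 1 1 1 "-1" 1 "-1"] sq'[of 1 1 "-1" 1 "-1" 1] sq'[of "-1" "-1" 1 1 1 1]
    by (simp_all add: choi_def zero algebra_simps)
  \<comment> \<open>Averaging removes the products of diagonal with off-diagonal coefficients and of
    two off-diagonal ones. The squares of the latter already sum to 6, hence contribute 24 to a
    total of 12.\<close>
  have "4 * (a + b + d)\<^sup>2 + 4 * (x\<^sup>2 + y\<^sup>2 + z\<^sup>2) =
      ((a + x) + (b + y) + (z + d))\<^sup>2 + ((a + x) + (b - y) + (d - z))\<^sup>2
    + ((a - x) + (b - y) + (z + d))\<^sup>2 + ((a - x) + (b + y) + (d - z))\<^sup>2" for a b d x y z :: real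
    by (simp add: power2_eq_square algebra_simps)
  then have "(\<Sum>k<N. 4 * (?a k + ?b k + ?d k)\<^sup>2 + 4 * ((?x k)\<^sup>2 + (?y k)\<^sup>2 + (?z k)\<^sup>2)) = 12"
    by (simp add: sum.distrib signs)
  then have "4 * (\<Sum>k<N. (?a k + ?b k + ?d k)\<^sup>2) = - 12"
    by (simp add: sum.distrib sum_distrib_left[symmetric] off)
  then show False
    using sum_nonneg[of "{..<N}" "\<lambda>k. (?a k + ?b k + ?d k)\<^sup>2"] by simp
qed

text \<open>In terms of coefficients, the forms at \<open>f1\<close> can contain only 1 and
  \<open>a * b\<close>, those at \<open>f2\<close> only \<open>a\<close> and \<open>b\<close>, so
  their products have no term in \<open>a * b\<close>, which \<open>biquadratic\<close> demands. The
  proof tests this along \<open>a = b = t\<close> by a derivative at 0.\<close>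

lemma biquadratic_not_sum_of_squares:
  fixes L :: "nat \<Rightarrow> 'a::real_normed_vector \<Rightarrow> 'b::real_vector \<Rightarrow> real"
  assumes lin: "\<And>k Y. linear (L k Y)" and poly: "\<And>k V. real_polynomial_function (\<lambda>Y. L k Y V)"
    and sq: "\<And>a b v1 v2. (\<Sum>k<N. (L k (a *\<^sub>R e1 + b *\<^sub>R e2) (v1 *\<^sub>R f1 + v2 *\<^sub>R f2))\<^sup>2)
        = biquadratic a b v1 v2"
  shows False
proof -
  have sq1: "(\<Sum>k<N. (L k (a *\<^sub>R e1 + b *\<^sub>R e2) f1)\<^sup>2) = 1 + (a * b)\<^sup>2"
    and sq2: "(\<Sum>k<N. (L k (a *\<^sub>R e1 + b *\<^sub>R e2) f2)\<^sup>2) = a\<^sup>2 + b\<^sup>2" for a b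
    using sq[of a b 1 0] sq[of a b 0 1] by (simp_all add: biquadratic_def)
  have mixed: "(\<Sum>k<N. L k (a *\<^sub>R e1 + b *\<^sub>R e2) f1 * L k (a *\<^sub>R e1 + b *\<^sub>R e2) f2) = - 2 * (a * b)" for a b
  proof -
    have "(\<Sum>k<N. (L k (a *\<^sub>R e1 + b *\<^sub>R e2) f1 + L k (a *\<^sub>R e1 + b *\<^sub>R e2) f2)\<^sup>2) = biquadratic a b 1 1"
      using sq[of a b 1 1] by (simp add: linear_add[OF lin])
    moreover have "(\<Sum>k<N. (f k + g k)\<^sup>2) = (\<Sum>k<N. (f k)\<^sup>2) + (\<Sum>k<N. (g k)\<^sup>2) + 2 * (\<Sum>k<N. f k * g k)"
      for f g :: "nat \<Rightarrow> real"
      by (simp add: power2_sum sum.distrib sum_distrib_left mult.assoc)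
    ultimately show ?thesis by (simp add: sq1 sq2 biquadratic_def)
  qed
  define D where "D k = frechet_derivative (\<lambda>Y. L k Y f1) (at 0)" for k
  have D: "((\<lambda>Y. L k Y f1) has_derivative D k) (at 0)" for k
    unfolding D_def frechet_derivative_works[symmetric]
    by (rule differentiable_at_real_polynomial_function[OF poly])
  have const: "L k (t *\<^sub>R e) f1 = L k 0 f1" if "k < N" and e: "e = e1 \<or> e = e2" for k t e
  proof -
    have "\<bar>L k (t *\<^sub>R e) f1\<bar> \<le> 1" for t
      using sum_squares_member_le[OF that(1), of "\<lambda>k. L k (t *\<^sub>R e) f1"] sq1[of t 0] sq1[of 0 t] e
      by (auto simp: abs_square_le_1)
    from real_polynomial_function_bounded_imp_const[OF real_polynomial_function_ray[OF poly] this, of t]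
    show ?thesis by simp
  qed
  \<comment> \<open>On either axis \<open>1 + (a * b)\<^sup>2\<close> is 1, so the forms at
    \<open>f1\<close> are constant there. By linearity their derivative at 0 also vanishes in the
    diagonal direction.\<close>
  have "D k e = 0" if "k < N" "e = e1 \<or> e = e2" for k e
    using has_derivative_imp_ray[OF D, of k e] unfolding const[OF that]
    using DERIV_const DERIV_unique by blast
  then have D0: "D k (e1 + e2) = 0" if "k < N" for k
    using that by (simp add: linear_add[OF has_derivative_linear[OF D]])
  have lin2: "L k (t *\<^sub>R (e1 + e2)) f2 = t * L k (e1 + e2) f2" if "k < N" for k t
  proof -
    have "(L k (t *\<^sub>R (e1 + e2)) f2)\<^sup>2 \<le> 2 * t\<^sup>2" for t
      using sum_squares_member_le[OF that, of "\<lambda>k. L k (t *\<^sub>R (e1 + e2)) f2"] sq2[of t t]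
      by (simp add: scaleR_add_right)
    from real_polynomial_function_linear_growth[OF real_polynomial_function_ray[OF poly] this]
    show ?thesis by simp
  qed
  \<comment> \<open>The mixed sum on the diagonal is \<open>- 2 * t\<^sup>2\<close>, and its second
    factor is linear in \<open>t\<close>. Dividing by \<open>t\<close> leaves \<open>S\<close>,
    whose slope at 0 must be both -2 and 0.\<close>
  define S where "S t = (\<Sum>k<N. L k (t *\<^sub>R (e1 + e2)) f1 * L k (e1 + e2) f2)" for t
  have "t * S t = t * (- 2 * t)" for t
    using mixed[of t t] lin2 unfolding S_def
    by (simp add: scaleR_add_right[symmetric] sum_distrib_left mult.left_commute mult.assoc cong: sum.cong_simp)
  then have S: "S t = - 2 * t" if "t \<noteq> 0" for t
    using that mult_left_cancel by blast
  have "(S has_real_derivative (\<Sum>k<N. D k (e1 + e2) * L k (e1 + e2) f2)) (at 0)"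
    unfolding S_def by (intro DERIV_sum DERIV_cmult_right has_derivative_imp_ray D)
  then have deriv: "(S has_real_derivative 0) (at 0)" using D0 by simp
  \<comment> \<open>Division by \<open>t\<close> says nothing at 0; the value there follows by
    continuity.\<close>
  have ev: "\<forall>\<^sub>F t in at 0. S t = - 2 * t" using S by (simp add: eventually_at_filter)
  have "((\<lambda>t. - 2 * t) \<longlongrightarrow> (0 :: real)) (at 0)" by (auto intro!: tendsto_eq_intros)
  moreover have "(S \<longlongrightarrow> S 0) (at 0)" using DERIV_isCont[OF deriv] by (simp add: isCont_def)
  ultimately have "S 0 = 0"
    using tendsto_unique[OF at_neq_bot] tendsto_cong[OF ev] by metis
  with S have "S = (\<lambda>t. - 2 * t)" by (metis mult_zero_right)
  then have "(S has_real_derivative - 2) (at 0)" by (auto intro!: derivative_eq_intros)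
  from DERIV_unique[OF this deriv] show False by simp
qed


section \<open>The counterexamples\<close>

abbreviation entry :: "real ^ 'n ^ 'm \<Rightarrow> 'm \<times> 'n \<Rightarrow> real"
  where "entry X p \<equiv> X $ fst p $ snd p"

abbreviation matrix_unit :: "'m::finite \<times> 'n::finite \<Rightarrow> real ^ 'n ^ 'm"
  where "matrix_unit p \<equiv> axis (fst p) (axis (snd p) 1)"

lemma entry_matrix_unit: "entry (matrix_unit p) q = (if p = q then 1 else 0)"
  by (auto simp: axis_def prod_eq_iff)

lemma entry_matrix_unit_inj:
  assumes "inj_on p S" "i \<in> S" "j \<in> S"
  shows "entry (matrix_unit (p i)) (p j) = (if i = j then 1 else 0)"
  unfolding entry_matrix_unit using inj_on_eq_iff[OF assms] by simp

lemma in_line_matrix_units: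
  assumes "fst a = fst c \<and> fst b = fst c \<or> snd a = snd c \<and> snd b = snd c"
  shows "in_line (u *\<^sub>R matrix_unit a + v *\<^sub>R matrix_unit b + w *\<^sub>R matrix_unit c)"
  using assms
proof
  assume "fst a = fst c \<and> fst b = fst c"
  then show ?thesis
    unfolding in_line_def by (intro disjI1 exI[of _ "fst c"]) (simp add: axis_def)
next
  assume "snd a = snd c \<and> snd b = snd c"
  then show ?thesis
    unfolding in_line_def by (intro disjI2 exI[of _ "snd c"]) (simp add: axis_def)
qed

lemma linear_vec_nth: "linear (\<lambda>z :: real ^ 'k::finite. z $ k)"
  by (rule linearI) auto

definition quartic_at :: "(nat \<Rightarrow> 'm \<times> 'n) \<Rightarrow> real ^ 'n ^ 'm \<Rightarrow> real"
  where "quartic_at p X =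
    quartic (entry X (p 0)) (entry X (p 1)) (entry X (p 2)) (entry X (p 3)) (entry X (p 4)) (entry X (p 5))"

definition sextic_at :: "(nat \<Rightarrow> 'm \<times> 'n) \<Rightarrow> real ^ 'n ^ 'm \<Rightarrow> real"
  where "sextic_at p X = sextic (entry X (p 0)) (entry X (p 1)) (entry X (p 2)) (entry X (p 3))"

lemma quartic_nonneg: "quartic x1 x2 x3 y1 y2 y3 \<ge> 0"
  using choi_nonneg[of x1 x2 x3 y1 y2 y3] by (simp add: quartic_def)

text \<open>The factor after \<open>t\<^sup>2\<close> is the function \<phi> that
  \<open>sos_polyconvex_hessian\<close> asks for; half its value at 0 is
  \<open>choi\<close>.\<close>

lemma quartic_second_difference:
  "quartic x1 x2 x3 (t * v1) (t * v2) (t * v3) + quartic x1 x2 x3 (- (t * v1)) (- (t * v2)) (- (t * v3))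
    - 2 * quartic x1 x2 x3 0 0 0
    = t\<^sup>2 * (2 * choi x1 x2 x3 v1 v2 v3 + 8 * t\<^sup>2 * (v1\<^sup>2 + v2\<^sup>2 + v3\<^sup>2)\<^sup>2)"
  unfolding quartic_def choi_def by (simp add: power2_eq_square algebra_simps)

lemma sextic_second_difference:
  "sextic a b (t * v1) (t * v2) + sextic a b (- (t * v1)) (- (t * v2)) - 2 * sextic a b 0 0
    = t\<^sup>2 * (2 * biquadratic a b v1 v2 + 2 * t\<^sup>2 * (2 + (a\<^sup>2 + b\<^sup>2)) * (v1\<^sup>2 + v2\<^sup>2)\<^sup>2
        + 4 * t ^ 4 * (v1\<^sup>2 + v2\<^sup>2) ^ 3)"
proof -
  define A P where "A = a\<^sup>2 + b\<^sup>2" and "P = v1\<^sup>2 + v2\<^sup>2"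
  have B: "biquadratic a b (t * v1) (t * v2) = t\<^sup>2 * biquadratic a b v1 v2"
    "biquadratic a b (- (t * v1)) (- (t * v2)) = t\<^sup>2 * biquadratic a b v1 v2"
    "biquadratic a b 0 0 = 0"
    by (simp_all add: biquadratic_def power2_eq_square algebra_simps)
  have P: "(t * v1)\<^sup>2 + (t * v2)\<^sup>2 = t\<^sup>2 * P"
    by (simp add: P_def power_mult_distrib algebra_simps)
  show ?thesis
    unfolding sextic_def B power2_minus P A_def[symmetric] P_def[symmetric]
    by (simp add: eval_nat_numeral algebra_simps)
qed

text \<open>The base point lives on positions 0 to 2 and the direction on positions 3 to 5, which
  share a row or column. The summand \<open>g\<close> has no second difference along such
  directions; it will be 0 or a minor.\<close>

lemma quartic_not_sos_polyconvex:
  fixes p :: "nat \<Rightarrow> 'm::{finite,linorder} \<times> 'n::{finite,linorder}"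
    and g :: "real ^ 'n::{finite,linorder} ^ 'm::{finite,linorder} \<Rightarrow> real"
  assumes inj: "inj_on p {..<6}"
    and line: "(\<exists>r. \<forall>k\<in>{3,4,5}. fst (p k) = r) \<or> (\<exists>s. \<forall>k\<in>{3,4,5}. snd (p k) = s)"
    and g: "\<And>Y V. in_line V \<Longrightarrow> g (Y + V) + g (Y - V) = 2 * g Y"
  shows "\<not> sos_polyconvex (\<lambda>X. quartic_at p X + g X)"
proof (rule notI, erule sos_polyconvex_hessian)
  fix L and N :: nat
  assume
    lin: "\<And>k Y. linear (L k Y)" and poly: "\<And>k V. real_polynomial_function (\<lambda>Y. L k Y V)"
    and hessian: "\<And>Y V \<phi>. in_line V \<Longrightarrow> isCont \<phi> 0 \<Longrightarrow>
       (\<And>t. quartic_at p (Y + t *\<^sub>R V) + g (Y + t *\<^sub>R V) + (quartic_at p (Y - t *\<^sub>R V) + g (Y - t *\<^sub>R V))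
          - 2 * (quartic_at p Y + g Y) = t\<^sup>2 * \<phi> t) \<Longrightarrow>
       (\<Sum>k<N. (L k Y V)\<^sup>2) = \<phi> 0 / 2"
  define E where "E k = matrix_unit (p k)" for k
  have E: "entry (E i) (p j) = (if i = j then 1 else 0)" if "i < 6" "j < 6" for i j
    unfolding E_def by (rule entry_matrix_unit_inj[OF inj]) (use that in simp_all)
  have "(\<Sum>k<N. (L k (x1 *\<^sub>R E 0 + x2 *\<^sub>R E 1 + x3 *\<^sub>R E 2) (v1 *\<^sub>R E 3 + v2 *\<^sub>R E 4 + v3 *\<^sub>R E 5))\<^sup>2)
      = choi x1 x2 x3 v1 v2 v3" for x1 x2 x3 v1 v2 v3
  proof -
    define Y where "Y = x1 *\<^sub>R E 0 + x2 *\<^sub>R E 1 + x3 *\<^sub>R E 2"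
    define V where "V = v1 *\<^sub>R E 3 + v2 *\<^sub>R E 4 + v3 *\<^sub>R E 5"
    define \<phi> where "\<phi> t = 2 * choi x1 x2 x3 v1 v2 v3 + 8 * t\<^sup>2 * (v1\<^sup>2 + v2\<^sup>2 + v3\<^sup>2)\<^sup>2" for t
    have V: "in_line V"
      using line unfolding V_def E_def by (intro in_line_matrix_units) auto
    have Y0: "entry Y (p 0) = x1" "entry Y (p 1) = x2" "entry Y (p 2) = x3"
      "entry Y (p 3) = 0" "entry Y (p 4) = 0" "entry Y (p 5) = 0"
      and V0: "entry V (p 0) = 0" "entry V (p 1) = 0" "entry V (p 2) = 0"
      "entry V (p 3) = v1" "entry V (p 4) = v2" "entry V (p 5) = v3"
      unfolding Y_def V_def by (simp_all add: E)
    have "isCont \<phi> 0" unfolding \<phi>_def by (intro continuous_intros)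
    moreover have "quartic_at p (Y + t *\<^sub>R V) + g (Y + t *\<^sub>R V) + (quartic_at p (Y - t *\<^sub>R V) + g (Y - t *\<^sub>R V))
        - 2 * (quartic_at p Y + g Y) = t\<^sup>2 * \<phi> t" for t
      using g[OF in_line_scaleR[OF V], of Y t] quartic_second_difference[of x1 x2 x3 t v1 v2 v3]
      unfolding quartic_at_def \<phi>_def by (simp add: Y0 V0 del: One_nat_def)
    ultimately have "(\<Sum>k<N. (L k Y V)\<^sup>2) = \<phi> 0 / 2" by (rule hessian[OF V])
    then show ?thesis by (simp add: Y_def V_def \<phi>_def)
  qed
  from choi_not_sum_of_squares[OF lin poly this] show False .
qed

text \<open>The direction is supported at positions 2 and 3, so the power of the entry at
  \<open>p 0\<close> does not change along it.\<close>

lemma sextic_not_sos_polyconvex: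
  fixes p :: "nat \<Rightarrow> 'm::{finite,linorder} \<times> 'n::{finite,linorder}"
  assumes inj: "inj_on p {..<4}" and line: "fst (p 2) = fst (p 3)"
  shows "\<not> sos_polyconvex (\<lambda>X. sextic_at p X + entry X (p 0) ^ d)"
proof (rule notI, erule sos_polyconvex_hessian)
  fix L and N :: nat
  assume
    lin: "\<And>k Y. linear (L k Y)" and poly: "\<And>k V. real_polynomial_function (\<lambda>Y. L k Y V)"
    and hessian: "\<And>Y V \<phi>. in_line V \<Longrightarrow> isCont \<phi> 0 \<Longrightarrow>
       (\<And>t. sextic_at p (Y + t *\<^sub>R V) + entry (Y + t *\<^sub>R V) (p 0) ^ d
          + (sextic_at p (Y - t *\<^sub>R V) + entry (Y - t *\<^sub>R V) (p 0) ^ d)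
          - 2 * (sextic_at p Y + entry Y (p 0) ^ d) = t\<^sup>2 * \<phi> t) \<Longrightarrow>
       (\<Sum>k<N. (L k Y V)\<^sup>2) = \<phi> 0 / 2"
  define E where "E k = matrix_unit (p k)" for k
  have E: "entry (E i) (p j) = (if i = j then 1 else 0)" if "i < 4" "j < 4" for i j
    unfolding E_def by (rule entry_matrix_unit_inj[OF inj]) (use that in simp_all)
  have "(\<Sum>k<N. (L k (a *\<^sub>R E 0 + b *\<^sub>R E 1) (v1 *\<^sub>R E 2 + v2 *\<^sub>R E 3))\<^sup>2) = biquadratic a b v1 v2"
    for a b v1 v2
  proof -
    define Y where "Y = a *\<^sub>R E 0 + b *\<^sub>R E 1"
    define V where "V = v1 *\<^sub>R E 2 + v2 *\<^sub>R E 3"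
    define \<phi> where "\<phi> t = 2 * biquadratic a b v1 v2 + 2 * t\<^sup>2 * (2 + (a\<^sup>2 + b\<^sup>2)) * (v1\<^sup>2 + v2\<^sup>2)\<^sup>2
        + 4 * t ^ 4 * (v1\<^sup>2 + v2\<^sup>2) ^ 3" for t
    have V: "in_line V"
      using in_line_matrix_units[of "p 2" "p 3" "p 3" v1 v2 0] line unfolding V_def E_def by simp
    have Y0: "entry Y (p 0) = a" "entry Y (p 1) = b" "entry Y (p 2) = 0" "entry Y (p 3) = 0"
      and V0: "entry V (p 0) = 0" "entry V (p 1) = 0" "entry V (p 2) = v1" "entry V (p 3) = v2"
      unfolding Y_def V_def by (simp_all add: E)
    have "isCont \<phi> 0" unfolding \<phi>_def by (intro continuous_intros)
    moreover have "sextic_at p (Y + t *\<^sub>R V) + entry (Y + t *\<^sub>R V) (p 0) ^ d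
        + (sextic_at p (Y - t *\<^sub>R V) + entry (Y - t *\<^sub>R V) (p 0) ^ d)
        - 2 * (sextic_at p Y + entry Y (p 0) ^ d) = t\<^sup>2 * \<phi> t" for t
      using sextic_second_difference[of a b t v1 v2]
      unfolding sextic_at_def \<phi>_def by (simp add: Y0 V0 del: One_nat_def)
    ultimately have "(\<Sum>k<N. (L k Y V)\<^sup>2) = \<phi> 0 / 2" by (rule hessian[OF V])
    then show ?thesis by (simp add: Y_def V_def \<phi>_def)
  qed
  from biquadratic_not_sum_of_squares[OF lin poly this] show False .
qed

section \<open>Degree bounds, polyconvexity and growth of the examples\<close>

lemma degree_le_add_max: "degree_le k f \<Longrightarrow> degree_le l g \<Longrightarrow> degree_le (max k l) (\<lambda>X. f X + g X)"
  by (rule degree_le_add; erule degree_le_mono) simp_all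

lemma degree_le_diff_max: "degree_le k f \<Longrightarrow> degree_le l g \<Longrightarrow> degree_le (max k l) (\<lambda>X. f X - g X)"
  by (rule degree_le_diff; erule degree_le_mono) simp_all

text \<open>Resolution with these rules computes some degree bound from the expression;
  \<open>degree_le_mono\<close> then compares it with the intended one.\<close>

lemmas degree_le_rules = degree_le_const[of 0] degree_le_entry[of 1, OF order_refl]
  degree_le_power degree_le_add_max degree_le_diff_max degree_le_mult

lemma degree_le_quartic_at: "degree_le 4 (quartic_at p)"
  unfolding quartic_at_def[abs_def] quartic_def choi_def
  by (rule degree_le_mono, (rule degree_le_rules)+) simp

lemma degree_le_sextic_at: "degree_le 6 (sextic_at p)"
  unfolding sextic_at_def[abs_def] sextic_def biquadratic_def
  by (rule degree_le_mono, (rule degree_le_rules)+) simp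

text \<open>A term linear in the minors is convex on the space of minors even where it is not convex
  in the matrix. This allows odd degrees.\<close>

lemma polyconvex_quartic_at:
  fixes p :: "nat \<Rightarrow> 'm::{finite,linorder} \<times> 'n::{finite,linorder}"
  assumes "linear l"
  shows "polyconvex (\<lambda>X. ereal (quartic_at p X + l (minors X)))"
proof (rule polyconvexI)
  let ?k = "\<lambda>i. entry_index (p i)"
  show "convex_on UNIV (\<lambda>z. quartic (z $ ?k 0) (z $ ?k 1) (z $ ?k 2) (z $ ?k 3) (z $ ?k 4) (z $ ?k 5) + l z)"
    by (intro convex_on_add convex_on_quartic linear_vec_nth convex_on_linear assms)
qed (simp add: quartic_at_def minors_entry_index)

lemma polyconvex_sextic_at:
  fixes p :: "nat \<Rightarrow> 'm::{finite,linorder} \<times> 'n::{finite,linorder}"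
  assumes "even d"
  shows "polyconvex (\<lambda>X. ereal (sextic_at p X + entry X (p 0) ^ d))"
proof (rule polyconvexI)
  let ?k = "\<lambda>i. entry_index (p i)"
  show "convex_on UNIV (\<lambda>z. sextic (z $ ?k 0) (z $ ?k 1) (z $ ?k 2) (z $ ?k 3) + (z $ ?k 0) ^ d)"
    by (intro convex_on_add convex_on_sextic convex_on_linear_power_even linear_vec_nth assms)
qed (simp add: sextic_at_def minors_entry_index)

lemma minors_Abs_minor_index:
  fixes X :: "real ^ 'n::{finite,linorder} ^ 'm::{finite,linorder}"
  assumes "card I = card J" "1 \<le> card I"
  shows "minors X $ Abs_minor_index (I, J) = minor X I J"
  using assms by (simp add: minors_def Abs_minor_index_inverse)

text \<open>The matrix is the identity on the block with rows \<open>I\<close> and columns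
  \<open>J\<close>. It provides the ray of growth for \<open>has_degreeI\<close>.\<close>

lemma minor_partial_permutation:
  fixes I :: "'m::{finite,linorder} set" and J :: "'n::{finite,linorder} set"
  assumes "card I = card J"
  obtains X where "\<And>t. minor (t *\<^sub>R X) I J = t ^ card I"
proof
  let ?r = "\<lambda>i. sorted_list_of_set I ! i" and ?s = "\<lambda>j. sorted_list_of_set J ! j"
  let ?X = "(\<chi> i j. if \<exists>k<card I. i = ?r k \<and> j = ?s k then 1 else 0) :: real ^ 'n::{finite,linorder} ^ 'm::{finite,linorder}"
  fix t
  have inj: "?r i = ?r k \<longleftrightarrow> i = k" "?s i = ?s k \<longleftrightarrow> i = k" if "i < card I" "k < card I" for i k
    using that assms by (simp_all add: nth_eq_iff_index_eq)
  have "?X $ ?r i $ ?s j = (if i = j then 1 else 0)" if "i < card I" "j < card I" for i j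
    using that inj by auto
  then have "Matrix.mat (card I) (card J) (\<lambda>(i, j). (t *\<^sub>R ?X) $ ?r i $ ?s j) = t \<cdot>\<^sub>m 1\<^sub>m (card I)"
    using assms by (intro eq_matI) auto
  then show "minor (t *\<^sub>R ?X) I J = t ^ card I"
    unfolding minor_def by simp
qed

section \<open>Choice of positions and the final case distinction\<close>

lemma obtain_list_distinct:
  assumes "k \<le> CARD('a::finite)"
  obtains xs :: "'a::finite list" where "distinct xs" "length xs = k"
proof -
  obtain S :: "'a set" where "card S = k"
    using assms obtain_subset_with_card_n[of k UNIV] by metis
  moreover obtain xs where "set xs = S" "distinct xs" using finite_distinct_list[of S] by auto
  ultimately show ?thesis using that distinct_card by metis
qed

lemma two_line_positions:
  assumes "2 \<le> CARD('a::finite)" "k \<le> CARD('b::finite)"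
  shows "\<exists>(p :: nat \<Rightarrow> 'a \<times> 'b) r. inj_on p {..<2 * k} \<and> (\<forall>i\<ge>k. fst (p i) = r)"
proof -
  obtain rs :: "'a list" where rs: "distinct rs" "length rs = 2" using obtain_list_distinct[OF assms(1)] .
  obtain cs :: "'b list" where cs: "distinct cs" "length cs = k" using obtain_list_distinct[OF assms(2)] .
  have neq: "rs ! 0 \<noteq> rs ! 1" using rs by (simp add: nth_eq_iff_index_eq)
  \<comment> \<open>From \<open>2 * k\<close> on the column is an unspecified list element, but
    injectivity is claimed only below \<open>2 * k\<close>, and the row is fixed from
    \<open>k\<close> on.\<close>
  let ?p = "\<lambda>i. if i < k then (rs ! 0, cs ! i) else (rs ! 1, cs ! (i - k))"
  have "inj_on ?p {..<2 * k}"
  proof (rule inj_onI)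
    fix i j assume "i \<in> {..<2 * k}" "j \<in> {..<2 * k}" "?p i = ?p j"
    then show "i = j"
      using neq cs by (cases "i < k"; cases "j < k") (simp_all add: nth_eq_iff_index_eq)
  qed
  moreover have "\<forall>i\<ge>k. fst (?p i) = rs ! 1" by simp
  ultimately show ?thesis by blast
qed

lemma quartic_positions:
  assumes "2 \<le> CARD('m::finite)" "2 \<le> CARD('n::finite)" "3 \<le> CARD('m) \<or> 3 \<le> CARD('n)"
  shows "\<exists>p :: nat \<Rightarrow> 'm \<times> 'n. inj_on p {..<6} \<and>
    ((\<exists>r. \<forall>k\<in>{3,4,5}. fst (p k) = r) \<or> (\<exists>s. \<forall>k\<in>{3,4,5}. snd (p k) = s))"
  using assms(3)
proof
  assume "3 \<le> CARD('n)"
  from two_line_positions[OF assms(1) this] obtain p :: "nat \<Rightarrow> 'm \<times> 'n" and r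
    where "inj_on p {..<6}" "\<forall>i\<ge>3. fst (p i) = r" by auto
  then show ?thesis by (intro exI[of _ p]) auto
next
  assume "3 \<le> CARD('m)"
  from two_line_positions[OF assms(2) this] obtain p :: "nat \<Rightarrow> 'n \<times> 'm" and r
    where p: "inj_on p {..<6}" "\<forall>i\<ge>3. fst (p i) = r" by auto
  have "inj_on (prod.swap \<circ> p) {..<6}"
    using p(1) by (intro comp_inj_on) (auto simp: inj_on_def prod_eq_iff)
  moreover have "\<forall>k\<in>{3,4,5}. snd ((prod.swap \<circ> p) k) = r" using p(2) by simp
  ultimately show ?thesis by blast
qed

text \<open>Odd degrees are restricted for a reason. A real-valued polyconvex function lies above an
  affine function of the minors, so an odd degree cannot exceed the largest order of a minor. In
  degree three the cubic part must be a combination of minors of order three, and the remainder, of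
  degree at most two, is again polyconvex and hence SOS polyconvex.\<close>

theorem theorem2p3:
  fixes d :: nat
  assumes "CARD('m::{finite,linorder}) \<ge> 2" and "CARD('n::{finite,linorder}) \<ge> 2"
    and "d > 2"
    and "(CARD('m), d) \<noteq> (2, 4) \<or> (CARD('n), d) \<noteq> (2, 4)"
    and "odd d \<longrightarrow> 5 \<le> d \<and> d \<le> min CARD('m) CARD('n)"
  shows "\<exists>f :: real ^ 'n::{finite,linorder} ^ 'm::{finite,linorder} \<Rightarrow> real.
    real_polynomial_function f \<and> has_degree f d \<and>
    polyconvex (\<lambda>X. ereal (f X)) \<and> \<not> sos_polyconvex f"
proof -
  consider "d = 4" | "odd d" | "even d" "d \<ge> 6" using assms(3) by fastforce
  then show ?thesis
  proof cases
    case 1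
    \<comment> \<open>For \<open>d = 4\<close> the hypothesis excludes exactly the case of 2 rows
      and 2 columns.\<close>
    then have "3 \<le> CARD('m) \<or> 3 \<le> CARD('n)" using assms(1,2,4) by auto
    from quartic_positions[OF assms(1,2) this] obtain p :: "nat \<Rightarrow> 'm \<times> 'n" where
      p: "inj_on p {..<6}" "(\<exists>r. \<forall>k\<in>{3,4,5}. fst (p k) = r) \<or> (\<exists>s. \<forall>k\<in>{3,4,5}. snd (p k) = s)"
      by blast
    define E where "E = matrix_unit (p 0)"
    have E: "entry E (p j) = (if j = 0 then 1 else 0)" if "j < 6" for j
      using entry_matrix_unit_inj[OF p(1), of 0 j] that unfolding E_def by simp
    have "t ^ 4 \<le> quartic_at p (t *\<^sub>R E)" for t
      by (simp add: quartic_at_def quartic_def choi_def E)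
    then have "has_degree (quartic_at p) 4" by (intro has_degreeI degree_le_quartic_at) auto
    moreover have "polyconvex (\<lambda>X. ereal (quartic_at p X))"
      using polyconvex_quartic_at[of "\<lambda>z. 0" p] by (simp add: linear_zero)
    moreover have "\<not> sos_polyconvex (quartic_at p)"
      using quartic_not_sos_polyconvex[OF p, of "\<lambda>X. 0"] by simp
    ultimately show ?thesis
      using degree_le_imp_real_polynomial_function[OF degree_le_quartic_at[of p]] 1 by blast
  next
    case 2
    with assms(5) have d: "5 \<le> d" "d \<le> CARD('m)" "d \<le> CARD('n)" by auto
    then have "3 \<le> CARD('m) \<or> 3 \<le> CARD('n)" by auto
    from quartic_positions[OF assms(1,2) this] obtain p :: "nat \<Rightarrow> 'm \<times> 'n" where
      p: "inj_on p {..<6}" "(\<exists>r. \<forall>k\<in>{3,4,5}. fst (p k) = r) \<or> (\<exists>s. \<forall>k\<in>{3,4,5}. snd (p k) = s)"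
      by blast
    obtain I :: "'m set" and J :: "'n set" where IJ: "card I = d" "card J = d"
      using obtain_subset_with_card_n[OF d(2)] obtain_subset_with_card_n[OF d(3)] by metis
    then have card: "card I = card J" "1 \<le> card I" using d by auto
    \<comment> \<open>As d \<ge> 5, the minor determines the degree; the quartic is nonnegative and
      does not spoil the growth.\<close>
    let ?f = "\<lambda>X. quartic_at p X + minor X I J"
    obtain X where "\<And>t. minor (t *\<^sub>R X) I J = t ^ d"
      using minor_partial_permutation[OF card(1)] IJ by metis
    then have "t ^ d \<le> ?f (t *\<^sub>R X)" for t
      using quartic_nonneg by (simp add: quartic_at_def)
    moreover have deg: "degree_le d ?f"
      using degree_le_minor[OF card(1)] degree_le_mono[OF degree_le_quartic_at, of d] IJ d
      by (intro degree_le_add) auto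
    ultimately have "has_degree ?f d" using d by (intro has_degreeI) auto
    moreover have "polyconvex (\<lambda>X. ereal (?f X))"
      using polyconvex_quartic_at[OF linear_vec_nth, of p "Abs_minor_index (I, J)"]
      by (simp add: minors_Abs_minor_index[OF card])
    moreover have "\<not> sos_polyconvex ?f"
      using quartic_not_sos_polyconvex[OF p minor_second_difference[OF _ card(1)]] by blast
    ultimately show ?thesis
      using degree_le_imp_real_polynomial_function[OF deg] by blast
  next
    case 3
    from two_line_positions[OF assms(1,2)] obtain p :: "nat \<Rightarrow> 'm \<times> 'n" and r
      where p: "inj_on p {..<4}" "\<forall>i\<ge>2. fst (p i) = r" by auto
    \<comment> \<open>The even power is convex and raises the degree from 6 to \<open>d\<close>; for
      \<open>d = 6\<close> both leading terms are positive on the chosen ray and do not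
      cancel.\<close>
    let ?f = "\<lambda>X. sextic_at p X + entry X (p 0) ^ d"
    define E where "E = matrix_unit (p 0)"
    have E: "entry E (p j) = (if j = 0 then 1 else 0)" if "j < 4" for j
      using entry_matrix_unit_inj[OF p(1), of 0 j] that unfolding E_def by simp
    have "t ^ d \<le> ?f (t *\<^sub>R E)" for t
      by (simp add: sextic_at_def sextic_def biquadratic_def E)
    moreover have deg: "degree_le d ?f"
      using degree_le_mono[OF degree_le_sextic_at, of d] 3
        degree_le_power[OF degree_le_entry[of 1], of d] by (intro degree_le_add) auto
    ultimately have "has_degree ?f d" using 3 by (intro has_degreeI) auto
    moreover have "polyconvex (\<lambda>X. ereal (?f X))"
      by (rule polyconvex_sextic_at[OF 3(1)])
    moreover have "\<not> sos_polyconvex ?f"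
      using p by (intro sextic_not_sos_polyconvex) auto
    ultimately show ?thesis
      using degree_le_imp_real_polynomial_function[OF deg] by blast
  qed
qed

end
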